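(* Let $G$ be a nonbipartite $\theta$-graph of order $n\geq 4$. (i) If $n$ is odd, then $q(C_{n})\leq q(G)$. Moreover, if equality holds, then $G\cong C_{n}$ or $G\cong H(i)$ for some integer $1\leq i\leq\frac{n-3}{2}$. (ii) If $n$ is even, then $q(\Theta)\leq q(G)$, with equality if and only if $G\cong\Theta$.
   Context: All graphs are finite, simple, undirected and connected. For a graph $G$, $Q(G)=D(G)+A(G)$ is the signless Laplacian matrix ($A(G)$ the adjacency matrix, $D(G)$ the diagonal matrix of vertex degrees), and $q(G)$ denotes the least eigenvalue of $Q(G)$. A $\theta$-graph is a simple 2-connected graph which is the union of three pairwise internally vertex-disjoint paths having the same two end vertices. $C_{n}=v_{0}v_{1}\cdots v_{n-1}v_{0}$ denotes the cycle on $n$ vertices. For odd $n\geq 5$ and an integer $1\leq i\leq\frac{n-3}{2}$, $H(i)$ is the graph obtained from $C_{n}$ by adding the edge $v_{i}v_{n-i}$. For even $n\geq 4$, $\Theta$ is the graph on vertices $v_{0},v_{1},\ldots,v_{n-1}$ consisting of the odd cycle $v_{1}v_{2}\cdots v_{n-1}v_{1}$ together with the two edges $v_{0}v_{2}$ and $v_{0}v_{n-1}$. *)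

theory Defs
  imports
    "Graph_Theory.Pair_Digraph"
    "Graph_Theory.Vertex_Walk"
    "Graph_Theory.Digraph_Isomorphism"
    "Jordan_Normal_Form.Spectral_Radius"
begin

text \<open>
  A finite simple undirected graph is a \<^locale>\<open>pair_graph\<close>: a finite vertex set together
  with a finite symmetric irreflexive set of ordered pairs, each edge \<open>uv\<close> being
  represented by both \<open>(u,v)\<close> and \<open>(v,u)\<close>. The symmetric closure is \<^const>\<open>symcl\<close>.
\<close>

definition bipartite :: "'a pair_pre_digraph \<Rightarrow> bool" where
  "bipartite G \<longleftrightarrow> (\<exists>X Y. pverts G = X \<union> Y \<and> X \<inter> Y = {} \<and>
     (\<forall>(u, v) \<in> parcs G. (u \<in> X \<and> v \<in> Y) \<or> (u \<in> Y \<and> v \<in> X)))"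

definition two_connected :: "'a pair_pre_digraph \<Rightarrow> bool" where
  "two_connected G \<longleftrightarrow> card (pverts G) \<ge> 3 \<and> Digraph_Component.connected (with_proj G) \<and>
     (\<forall>v \<in> pverts G. Digraph_Component.connected (pre_digraph.del_vert (with_proj G) v))"

definition path_between :: "'a pair_pre_digraph \<Rightarrow> 'a \<Rightarrow> 'a vwalk \<Rightarrow> 'a \<Rightarrow> bool" where
  "path_between G u p v \<longleftrightarrow> vpath p (with_proj G) \<and> hd p = u \<and> last p = v"

definition internal_verts :: "'a vwalk \<Rightarrow> 'a set" where
  "internal_verts p = set (butlast (tl p))"

text \<open>
  Internal disjointness does not by itself exclude using the same edge \<open>uv\<close> twice as a path
  of length one; that is ruled out by requiring the three paths to be distinct.
\<close>

definition theta_graph :: "'a pair_pre_digraph \<Rightarrow> bool" where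
  "theta_graph G \<longleftrightarrow> pair_graph G \<and> two_connected G \<and>
     (\<exists>u v p q r. u \<noteq> v \<and> path_between G u p v \<and> path_between G u q v \<and> path_between G u r v \<and>
        distinct [p, q, r] \<and>
        internal_verts p \<inter> internal_verts q = {} \<and>
        internal_verts p \<inter> internal_verts r = {} \<and>
        internal_verts q \<inter> internal_verts r = {} \<and>
        pverts G = set p \<union> set q \<union> set r \<and>
        parcs G = symcl (set (vwalk_arcs p) \<union> set (vwalk_arcs q) \<union> set (vwalk_arcs r)))"

text \<open>The matrices depend on an enumeration \<open>f\<close> of the vertices by \<open>0, \<dots>, n - 1\<close>.\<close>

definition adjacency_matrix :: "(nat \<Rightarrow> 'a) \<Rightarrow> 'a pair_pre_digraph \<Rightarrow> real mat" where
  "adjacency_matrix f G = (let n = card (pverts G) in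
     mat n n (\<lambda>(i, j). if (f i, f j) \<in> parcs G then 1 else 0))"

definition degree_matrix :: "(nat \<Rightarrow> 'a) \<Rightarrow> 'a pair_pre_digraph \<Rightarrow> real mat" where
  "degree_matrix f G = (let n = card (pverts G) in
     mat n n (\<lambda>(i, j). if i = j then real (out_degree (with_proj G) (f i)) else 0))"

definition signless_laplacian :: "(nat \<Rightarrow> 'a) \<Rightarrow> 'a pair_pre_digraph \<Rightarrow> real mat" where
  "signless_laplacian f G = degree_matrix f G + adjacency_matrix f G"

definition vertex_enum :: "'a pair_pre_digraph \<Rightarrow> nat \<Rightarrow> 'a" where
  "vertex_enum G = (SOME f. bij_betw f {..<card (pverts G)} (pverts G))"

definition least_Q_eigenvalue :: "'a pair_pre_digraph \<Rightarrow> real" where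
  "least_Q_eigenvalue G = Min (spectrum (signless_laplacian (vertex_enum G) G))"

text \<open>The choice of enumeration is immaterial.\<close>

lemma spectrum_signless_laplacian_subset:
  assumes f: "bij_betw f {..<card (pverts G)} (pverts G)"
    and g: "bij_betw g {..<card (pverts G)} (pverts G)"
  shows "spectrum (signless_laplacian f G) \<subseteq> spectrum (signless_laplacian g G)"
proof
  fix k assume "k \<in> spectrum (signless_laplacian f G)"
  define n where "n = card (pverts G)"
  define s where "s = the_inv_into {..<n} f \<circ> g"
  have bs: "bij_betw s {..<n} {..<n}"
    unfolding s_def n_def by (rule bij_betw_trans[OF g bij_betw_the_inv_into[OF f]])
  have fs: "f (s i) = g i" if "i < n" for i
    using that f g unfolding s_def n_def
    by (simp add: f_the_inv_into_f bij_betw_def) (metis f_the_inv_into_f imageI lessThan_iff)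
  have sn: "s i < n" if "i < n" for i using bs that by (auto simp: bij_betw_def)
  have sinj: "s i = s j \<longleftrightarrow> i = j" if "i < n" "j < n" for i j
    using bs that by (auto simp: bij_betw_def inj_on_def)
  let ?A = "signless_laplacian f G" and ?B = "signless_laplacian g G"
  have dims: "dim_row ?A = n" "dim_col ?A = n" "dim_row ?B = n" "dim_col ?B = n"
    by (simp_all add: signless_laplacian_def adjacency_matrix_def degree_matrix_def Let_def n_def)
  have AB: "?B $$ (i, j) = ?A $$ (s i, s j)" if "i < n" "j < n" for i j
    using that sn[OF that(1)] sn[OF that(2)] fs[OF that(1)] fs[OF that(2)] sinj[OF that]
    by (simp add: signless_laplacian_def adjacency_matrix_def degree_matrix_def Let_def
        n_def[symmetric])
  from \<open>k \<in> spectrum ?A\<close> obtain v where v: "v \<in> carrier_vec n" "v \<noteq> 0\<^sub>v n" "?A *\<^sub>v v = k \<cdot>\<^sub>v v"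
    by (auto simp: spectrum_def eigenvalue_def eigenvector_def dims)
  define w where "w = vec n (\<lambda>i. v $ s i)"
  have "w \<noteq> 0\<^sub>v n"
  proof
    assume w0: "w = 0\<^sub>v n"
    have "v $ j = 0" if "j < n" for j
    proof -
      from that bs obtain i where "i < n" "s i = j" unfolding bij_betw_def by (metis imageE lessThan_iff)
      then show ?thesis using arg_cong[OF w0, of "\<lambda>x. x $ i"] by (simp add: w_def)
    qed
    with v show False by (auto simp: vec_eq_iff)
  qed
  moreover have "?B *\<^sub>v w = k \<cdot>\<^sub>v w"
  proof (rule eq_vecI)
    fix i assume "i < dim_vec (k \<cdot>\<^sub>v w)"
    then have i: "i < n" by (simp add: w_def)
    have "(?B *\<^sub>v w) $ i = (\<Sum>j<n. ?A $$ (s i, s j) * v $ s j)"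
      using i by (simp add: scalar_prod_def dims w_def AB atLeast0LessThan)
    also have "\<dots> = (\<Sum>j<n. ?A $$ (s i, j) * v $ j)"
      by (rule sum.reindex_bij_betw[OF bs])
    also have "\<dots> = (?A *\<^sub>v v) $ s i"
      using sn[OF i] v(1) by (simp add: scalar_prod_def dims atLeast0LessThan)
    also have "\<dots> = (k \<cdot>\<^sub>v w) $ i"
      using v(1) sn[OF i] i by (simp add: v(3) w_def)
    finally show "(?B *\<^sub>v w) $ i = (k \<cdot>\<^sub>v w) $ i" .
  qed (simp add: w_def dims)
  moreover have "w \<in> carrier_vec n" by (simp add: w_def)
  ultimately show "k \<in> spectrum ?B"
    by (auto simp: spectrum_def eigenvalue_def eigenvector_def dims)
qed

lemma least_Q_eigenvalue_enum:
  assumes "bij_betw f {..<card (pverts G)} (pverts G)"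
  shows "least_Q_eigenvalue G = Min (spectrum (signless_laplacian f G))"
proof -
  have "bij_betw (vertex_enum G) {..<card (pverts G)} (pverts G)"
    unfolding vertex_enum_def by (rule someI[where P = "\<lambda>f. bij_betw f _ _", OF assms])
  then show ?thesis
    unfolding least_Q_eigenvalue_def
    using assms spectrum_signless_laplacian_subset by (metis subset_antisym)
qed

abbreviation graph_iso :: "'a pair_pre_digraph \<Rightarrow> 'b pair_pre_digraph \<Rightarrow> bool" (infix "\<simeq>\<^sub>G" 50) where
  "G \<simeq>\<^sub>G H \<equiv> digraph_iso (with_proj G) (with_proj H)"

text \<open>In the following graphs the vertex \<open>v\<^sub>i\<close> is the natural number \<open>i\<close>.\<close>

definition cycle_graph :: "nat \<Rightarrow> nat pair_pre_digraph" where
  "cycle_graph n = \<lparr> pverts = {..<n}, parcs = symcl {(i, (i + 1) mod n) | i. i < n} \<rparr>"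

definition H_graph :: "nat \<Rightarrow> nat \<Rightarrow> nat pair_pre_digraph" where
  "H_graph n i = \<lparr> pverts = pverts (cycle_graph n),
                   parcs = parcs (cycle_graph n) \<union> symcl {(i, n - i)} \<rparr>"

definition Theta_graph :: "nat \<Rightarrow> nat pair_pre_digraph" where
  "Theta_graph n = \<lparr> pverts = {..<n},
     parcs = symcl ({(j, j + 1) | j. 1 \<le> j \<and> j + 1 < n} \<union> {(n - 1, 1)} \<union> {(0, 2), (0, n - 1)}) \<rparr>"

end

theory Submission
  imports Defs
begin

text \<open>
  Alternating the signs along the three paths of a \<open>\<theta>\<close>-graph, of lengths \<open>a\<close>, \<open>b\<close> of equal parity
  and \<open>c\<close> of the other one, turns the signless form into sums of squared differences along the
  paths, except that the end values \<open>X\<close>, \<open>Y\<close> of the first two paths become \<open>X\<close>, \<open>- Y\<close> on the third.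
  With the eigenvalue parametrised as \<open>4 sin\<^sup>2 \<psi>\<close>, minimising over the interior of each path leaves a
  quadratic form in \<open>X\<close>, \<open>Y\<close> that is diagonal in \<open>X + Y\<close>, \<open>X - Y\<close>, with coefficients proportional to
  \<open>tan \<psi> - tan a\<psi> - tan b\<psi> + cot c\<psi>\<close> and \<open>tan \<psi> + cot a\<psi> + cot b\<psi> - tan c\<psi>\<close>.
  For odd \<open>n = a + b + c - 1\<close> take \<open>\<psi> = \<pi> / 2n\<close>, which belongs to the cycle; for even \<open>n\<close> take the
  zero \<open>\<psi>\<close> of the first coefficient for \<open>a = b = 2\<close>, which belongs to \<open>\<Theta>\<close>. Convexity of the tangent
  makes the first coefficient nonnegative, and positive away from the extremal lengths.
\<close>

subsection \<open>The Dirichlet form of a path\<close>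

text \<open>The term with \<open>q\<close> runs over interior positions only: the three paths share
  their end vertices, whose terms are subtracted once for the whole graph.\<close>

definition path_energy :: "real \<Rightarrow> nat \<Rightarrow> (nat \<Rightarrow> real) \<Rightarrow> real" where
  "path_energy q l f = (\<Sum>k<l. (f k - f (Suc k))\<^sup>2) - q * (\<Sum>k\<in>{0<..<l}. (f k)\<^sup>2)"

lemma path_energy_Suc:
  assumes "l \<ge> 1"
  shows "path_energy q (Suc l) f = path_energy q l f + (f l - f (Suc l))\<^sup>2 - q * (f l)\<^sup>2"
proof -
  have "{0<..<Suc l} = insert l {0<..<l}" using assms by auto
  then show ?thesis by (simp add: path_energy_def algebra_simps)
qed

text \<open>Here \<open>p, P, P1\<close> are the sines and \<open>d, D, D1\<close> the cosines of \<open>\<phi>\<close>, \<open>l\<phi>\<close>, \<open>(l + 1)\<phi>\<close>: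
  eliminating the last interior vertex of a path completes a square.\<close>

lemma dirichlet_form_step:
  fixes p d P D X Y Z :: real
  assumes pd: "d\<^sup>2 + p\<^sup>2 = 1" and PD: "D\<^sup>2 + P\<^sup>2 = 1"
    and P1: "P1 = P * d + D * p" and D1: "D1 = D * d - P * p" and nz: "P \<noteq> 0" "P1 \<noteq> 0"
  shows "(1 - d) * (X\<^sup>2 + Z\<^sup>2) + p * ((X\<^sup>2 + Z\<^sup>2) * D - 2 * X * Z) / P + (Z - Y)\<^sup>2 - 2 * (1 - d) * Z\<^sup>2
       - ((1 - d) * (X\<^sup>2 + Y\<^sup>2) + p * ((X\<^sup>2 + Y\<^sup>2) * D1 - 2 * X * Y) / P1)
       = P1 / P * (Z - (p * X + P * Y) / P1)\<^sup>2"
proof -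
  have "D * P1 - D1 * P = p * (D\<^sup>2 + P\<^sup>2)" "d * P1 - p * D1 = P * (d\<^sup>2 + p\<^sup>2)"
    unfolding P1 D1 by (simp_all add: algebra_simps power2_eq_square)
  then have x: "D * P1 - D1 * P = p" and y: "d * P1 - p * D1 = P"
    unfolding pd PD by simp_all
  have X: "p * D / P - p * D1 / P1 = p\<^sup>2 / (P * P1)"
  proof -
    have "p * D / P - p * D1 / P1 = p * (D * P1 - D1 * P) / (P * P1)"
      using nz by (simp add: field_simps)
    then show ?thesis unfolding x by (simp add: power2_eq_square)
  qed
  have Y: "d - p * D1 / P1 = P / P1"
    using nz y by (simp add: field_simps)
  have Z: "d + p * D / P = P1 / P"
    using nz P1 by (simp add: field_simps)
  have "(1 - d) * (X\<^sup>2 + Z\<^sup>2) + p * ((X\<^sup>2 + Z\<^sup>2) * D - 2 * X * Z) / P + (Z - Y)\<^sup>2 - 2 * (1 - d) * Z\<^sup>2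
       - ((1 - d) * (X\<^sup>2 + Y\<^sup>2) + p * ((X\<^sup>2 + Y\<^sup>2) * D1 - 2 * X * Y) / P1)
     = X\<^sup>2 * (p * D / P - p * D1 / P1) + Y\<^sup>2 * (d - p * D1 / P1) + Z\<^sup>2 * (d + p * D / P)
       - 2 * X * Z * p / P - 2 * Y * Z + 2 * X * Y * p / P1"
    by (simp add: algebra_simps power2_eq_square add_divide_distrib diff_divide_distrib)
  also have "\<dots> = P1 / P * (Z - (p * X + P * Y) / P1)\<^sup>2"
    unfolding X Y Z using nz by (simp add: field_simps power2_eq_square)
  finally show ?thesis .
qed

text \<open>The lower bound is the minimum of the energy over the interior values for fixed
  \<open>f 0\<close> and \<open>f l\<close>. Induction eliminates the last interior vertex: each
  step leaves a square with coefficient \<open>sin (Suc l * \<phi>) / sin (l * \<phi>)\<close>,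
  positive because both angles lie below \<open>pi\<close>.\<close>

lemma path_energy_ge_double_angle:
  assumes "l \<ge> 1" "0 < \<phi>" "real l * \<phi> < pi"
  shows "(1 - cos \<phi>) * ((f 0)\<^sup>2 + (f l)\<^sup>2)
      + sin \<phi> * (((f 0)\<^sup>2 + (f l)\<^sup>2) * cos (l * \<phi>) - 2 * f 0 * f l) / sin (l * \<phi>)
    \<le> path_energy (2 * (1 - cos \<phi>)) l f"
  using assms(1,3)
proof (induction l rule: dec_induct)
  \<comment> \<open>A single edge gives equality: after cancelling \<open>sin \<phi>\<close> both
    sides are the squared difference of the end values.\<close>
  case base
  have "sin \<phi> > 0" using assms base by (intro sin_gt_zero) auto
  moreover have "{0<..<Suc 0} = {}" by auto
  ultimately show ?case by (simp add: path_energy_def power2_eq_square field_simps)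
next
  case (step l)
  have lt: "real l * \<phi> < pi" using step.prems assms(2) by (simp add: algebra_simps)
  have S: "sin (l * \<phi>) > 0" using assms(2) lt step.hyps by (intro sin_gt_zero) auto
  have S1: "sin (Suc l * \<phi>) > 0" using assms(2) step.prems by (intro sin_gt_zero) auto
  have "0 \<le> sin (Suc l * \<phi>) / sin (l * \<phi>)
      * (f l - (sin \<phi> * f 0 + sin (l * \<phi>) * f (Suc l)) / sin (Suc l * \<phi>))\<^sup>2"
    using S S1 by (intro mult_nonneg_nonneg) auto
  also have "\<dots> = (1 - cos \<phi>) * ((f 0)\<^sup>2 + (f l)\<^sup>2)
      + sin \<phi> * (((f 0)\<^sup>2 + (f l)\<^sup>2) * cos (l * \<phi>) - 2 * f 0 * f l) / sin (l * \<phi>)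
      + (f l - f (Suc l))\<^sup>2 - 2 * (1 - cos \<phi>) * (f l)\<^sup>2
      - ((1 - cos \<phi>) * ((f 0)\<^sup>2 + (f (Suc l))\<^sup>2)
      + sin \<phi> * (((f 0)\<^sup>2 + (f (Suc l))\<^sup>2) * cos (Suc l * \<phi>) - 2 * f 0 * f (Suc l)) / sin (Suc l * \<phi>))"
    using S S1 by (intro dirichlet_form_step[symmetric])
      (auto simp: distrib_right sin_add cos_add algebra_simps)
  finally show ?case
    using step.IH[OF lt] path_energy_Suc[OF step.hyps(1), of "2 * (1 - cos \<phi>)" f] by linarith
qed

text \<open>Put \<phi> = 2\<psi> and t = l\<psi>. The numerator (X^2 + Y^2) cos 2t - 2XY equals (X -
  Y)^2 cos^2 t - (X + Y)^2 sin^2 t, and dividing by sin 2t = 2 sin t cos t makes the bound diagonal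
  in X - Y and X + Y.\<close>

lemma path_energy_ge:
  assumes "l \<ge> 1" "0 < \<psi>" "real l * \<psi> < pi / 2"
  shows "2 * (sin \<psi>)\<^sup>2 * ((f 0)\<^sup>2 + (f l)\<^sup>2)
      + sin \<psi> * cos \<psi> * ((f 0 - f l)\<^sup>2 * cot (l * \<psi>) - (f 0 + f l)\<^sup>2 * tan (l * \<psi>))
    \<le> path_energy (4 * (sin \<psi>)\<^sup>2) l f"
proof -
  define S C X Y where "S = sin (l * \<psi>)" and "C = cos (l * \<psi>)" and "X = f 0" and "Y = f l"
  have "real l * \<psi> > 0" using assms by simp
  then have "real l * \<psi> < pi" "- (pi / 2) < real l * \<psi>" using assms(3) pi_gt_zero by linarith+
  then have SC: "S > 0" "C > 0" unfolding S_def C_def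
    using \<open>real l * \<psi> > 0\<close> assms(3) by (auto intro!: sin_gt_zero cos_gt_zero_pi)
  have sc: "S\<^sup>2 + C\<^sup>2 = 1" by (simp add: S_def C_def)
  have c2: "cos (l * (2 * \<psi>)) = C\<^sup>2 - S\<^sup>2" "sin (l * (2 * \<psi>)) = 2 * S * C"
    unfolding S_def C_def using cos_double[of "l * \<psi>"] sin_double[of "l * \<psi>"] by (simp_all add: mult_ac)
  have eq: "(X - Y)\<^sup>2 * (C / S) - (X + Y)\<^sup>2 * (S / C)
      = 2 * (((X\<^sup>2 + Y\<^sup>2) * (C\<^sup>2 - S\<^sup>2) - 2 * X * Y) / (2 * S * C))"
  proof -
    have "(X - Y)\<^sup>2 * (C * C) - (X + Y)\<^sup>2 * (S * S)
      = ((X\<^sup>2 + Y\<^sup>2) * (C\<^sup>2 - S\<^sup>2) - 2 * X * Y * (S\<^sup>2 + C\<^sup>2))"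
      by (simp add: power2_eq_square algebra_simps)
    then have "(X - Y)\<^sup>2 * (C * C) - (X + Y)\<^sup>2 * (S * S)
      = ((X\<^sup>2 + Y\<^sup>2) * (C\<^sup>2 - S\<^sup>2) - 2 * X * Y)" unfolding sc by simp
    moreover have "(X - Y)\<^sup>2 * (C / S) - (X + Y)\<^sup>2 * (S / C)
      = ((X - Y)\<^sup>2 * (C * C) - (X + Y)\<^sup>2 * (S * S)) / (S * C)"
      using SC by (simp add: field_simps)
    moreover have "2 * (N / (2 * S * C)) = N / (S * C)" for N by simp
    ultimately show ?thesis by (simp only:)
  qed
  have q: "1 - cos (2 * \<psi>) = 2 * (sin \<psi>)\<^sup>2" by (simp add: cos_double_sin)
  have "real l * (2 * \<psi>) < pi" using assms by simp
  from path_energy_ge_double_angle[OF assms(1) _ this, of f] assms(2) show ?thesis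
    unfolding cot_def tan_def S_def[symmetric] C_def[symmetric] X_def[symmetric] Y_def[symmetric] q
      sin_double c2 eq by (simp add: mult_ac)
qed

text \<open>The angle condition puts 4 sin^2 \<psi> below the first Dirichlet eigenvalue 4 sin^2 (pi
  / 2l) of the path, so the energy is positive definite on functions vanishing at both ends. The
  induction shows that the last interior value vanishes and passes to the shorter path.\<close>

lemma path_energy_dirichlet_zero:
  assumes "l \<ge> 1" "0 < \<psi>" "real l * \<psi> < pi / 2"
    and "f 0 = 0" "f l = 0" "path_energy (4 * (sin \<psi>)\<^sup>2) l f \<le> 0" "k \<le> l"
  shows "f k = 0"
proof -
  define \<phi> where "\<phi> = 2 * \<psi>"
  have \<phi>: "0 < \<phi>" "real l * \<phi> < pi" using assms by (auto simp: \<phi>_def)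
  have q: "4 * (sin \<psi>)\<^sup>2 = 2 * (1 - cos \<phi>)" by (simp add: \<phi>_def cos_double_sin)
  from assms(1) \<phi>(2) assms(5-7)[unfolded q] show ?thesis
  proof (induction l rule: dec_induct)
    case base
    then show ?case using \<open>f 0 = 0\<close> by (metis One_nat_def le_Suc_eq le_zero_eq)
  next
    case (step l)
    have lt: "real l * \<phi> < pi" using step.prems \<phi>(1) by (simp add: algebra_simps)
    have S: "sin (l * \<phi>) > 0" using \<phi>(1) lt step.hyps by (intro sin_gt_zero) auto
    have S1: "sin (Suc l * \<phi>) > 0" using \<phi>(1) step.prems by (intro sin_gt_zero) auto
    \<comment> \<open>Since \<open>f (Suc l) = 0\<close>, the last edge and the vertex at position
      \<open>l\<close> add only a multiple of \<open>(f l)\<^sup>2\<close>. Together with the bound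
      for the first \<open>l\<close> edges its coefficient becomes a quotient of two positive
      sines.\<close>
    have "path_energy (2 * (1 - cos \<phi>)) l f + (2 * cos \<phi> - 1) * (f l)\<^sup>2 \<le> 0"
      using step.prems path_energy_Suc[OF step.hyps(1), of "2 * (1 - cos \<phi>)" f]
      by (simp add: algebra_simps)
    moreover have "(1 - cos \<phi> + sin \<phi> * cos (l * \<phi>) / sin (l * \<phi>)) * (f l)\<^sup>2
        \<le> path_energy (2 * (1 - cos \<phi>)) l f"
      using path_energy_ge_double_angle[OF step.hyps(1) \<phi>(1) lt, of f] \<open>f 0 = 0\<close>
      by (simp add: algebra_simps)
    moreover have eq: "(1 - cos \<phi> + sin \<phi> * cos (l * \<phi>) / sin (l * \<phi>)) + (2 * cos \<phi> - 1)
        = sin (Suc l * \<phi>) / sin (l * \<phi>)"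
      using S by (simp add: field_simps sin_add)
    ultimately have "sin (Suc l * \<phi>) / sin (l * \<phi>) * (f l)\<^sup>2 \<le> 0"
      unfolding eq[symmetric] distrib_right by linarith
    then have fl: "f l = 0"
      using divide_pos_pos[OF S1 S] by (metis mult_pos_pos not_le zero_less_power2)
    then have "path_energy (2 * (1 - cos \<phi>)) l f \<le> 0"
      using step.prems path_energy_Suc[OF step.hyps(1), of "2 * (1 - cos \<phi>)" f] by simp
    with step.IH[OF lt fl this] step.prems show ?case by (cases "k = Suc l") auto
  qed
qed

section \<open>The quadratic form in the two branch values\<close>

definition theta_sym :: "real \<Rightarrow> nat \<Rightarrow> nat \<Rightarrow> nat \<Rightarrow> real" where
  "theta_sym \<psi> a b c = tan \<psi> - tan (a * \<psi>) - tan (b * \<psi>) + cot (c * \<psi>)"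

definition theta_anti :: "real \<Rightarrow> nat \<Rightarrow> nat \<Rightarrow> nat \<Rightarrow> real" where
  "theta_anti \<psi> a b c = tan \<psi> + cot (a * \<psi>) + cot (b * \<psi>) - tan (c * \<psi>)"

text \<open>Each path contributes 2 sin^2 \<psi> (X^2 + Y^2); of the total factor 6 the two branch
  vertices take away 4, and what remains is the \<open>tan \<psi>\<close> in both coefficients. On
  the third path the end value \<open>- Y\<close> exchanges the roles of X + Y and X - Y, hence
  those of \<open>cot\<close> and \<open>tan\<close>.\<close>

lemma theta_energy_ge:
  assumes len: "a \<ge> 1" "b \<ge> 1" "c \<ge> 1" and \<psi>: "0 < \<psi>" "\<psi> < pi / 2"
    and lt: "real a * \<psi> < pi / 2" "real b * \<psi> < pi / 2" "real c * \<psi> < pi / 2"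
    and ends: "f a = Y" "g b = Y" "h c = - Y" "f 0 = X" "g 0 = X" "h 0 = X"
  shows "sin \<psi> * cos \<psi> * ((X + Y)\<^sup>2 * theta_sym \<psi> a b c + (X - Y)\<^sup>2 * theta_anti \<psi> a b c)
    \<le> path_energy (4 * (sin \<psi>)\<^sup>2) a f + path_energy (4 * (sin \<psi>)\<^sup>2) b g
      + path_energy (4 * (sin \<psi>)\<^sup>2) c h - 4 * (sin \<psi>)\<^sup>2 * (X\<^sup>2 + Y\<^sup>2)"
proof -
  have "cos \<psi> > 0" using \<psi> by (intro cos_gt_zero_pi) auto
  then have t: "sin \<psi> * cos \<psi> * tan \<psi> = (sin \<psi>)\<^sup>2" by (simp add: tan_def power2_eq_square)
  have "sin \<psi> * cos \<psi> * ((X + Y)\<^sup>2 * theta_sym \<psi> a b c + (X - Y)\<^sup>2 * theta_anti \<psi> a b c)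
    = (sin \<psi> * cos \<psi> * tan \<psi>) * (2 * (X\<^sup>2 + Y\<^sup>2))
     + sin \<psi> * cos \<psi> * ((X - Y)\<^sup>2 * cot (a * \<psi>) - (X + Y)\<^sup>2 * tan (a * \<psi>))
     + sin \<psi> * cos \<psi> * ((X - Y)\<^sup>2 * cot (b * \<psi>) - (X + Y)\<^sup>2 * tan (b * \<psi>))
     + sin \<psi> * cos \<psi> * ((X + Y)\<^sup>2 * cot (c * \<psi>) - (X - Y)\<^sup>2 * tan (c * \<psi>))"
    unfolding theta_sym_def theta_anti_def by (simp add: power2_eq_square algebra_simps)
  then show ?thesis
    using path_energy_ge[OF len(1) \<psi>(1) lt(1), of f] path_energy_ge[OF len(2) \<psi>(1) lt(2), of g]
      path_energy_ge[OF len(3) \<psi>(1) lt(3), of h]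
    unfolding t ends by (simp add: algebra_simps)
qed

section \<open>Signs of the two coefficients\<close>

text \<open>Convexity of the tangent in the form of increments: the increment at z is sin d / (cos z
  cos (z + d)), and both cosines decrease in z.\<close>

lemma tan_add_diff_mono:
  fixes x y d :: real
  assumes "0 \<le> x" "x \<le> y" "0 \<le> d" "y + d < pi / 2"
  shows "tan (x + d) - tan x \<le> tan (y + d) - tan y"
    and "x < y \<Longrightarrow> 0 < d \<Longrightarrow> tan (x + d) - tan x < tan (y + d) - tan y"
proof -
  have diff: "tan (z + d) - tan z = sin d / (cos z * cos (z + d))" if "0 \<le> z" "z \<le> y" for z
  proof -
    have "cos z \<noteq> 0" "cos (z + d) \<noteq> 0" using that assms
      by (auto intro!: less_imp_neq[symmetric] cos_gt_zero_pi)
    then show ?thesis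
      using sin_diff[of "z + d" z] by (simp add: tan_def field_simps)
  qed
  have cy: "cos y > 0" "cos (y + d) > 0" using assms by (auto intro!: cos_gt_zero_pi)
  have le: "cos y \<le> cos x" "cos (y + d) \<le> cos (x + d)"
    using assms by (auto intro!: cos_monotone_0_pi_le)
  have m: "cos y * cos (y + d) \<le> cos x * cos (x + d)"
    using cy le by (intro mult_mono) auto
  have s: "sin d \<ge> 0" using assms by (intro sin_ge_zero) auto
  show "tan (x + d) - tan x \<le> tan (y + d) - tan y"
    using diff[of x] diff[of y] assms m s mult_pos_pos[OF cy]
    by (simp add: divide_left_mono)
  assume xy: "x < y" "0 < d"
  have "cos y < cos x" using assms xy by (intro cos_monotone_0_pi) auto
  then have m: "cos y * cos (y + d) < cos x * cos (x + d)"
    using cy le by (intro mult_less_le_imp_less) auto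
  have s: "sin d > 0" using assms xy by (intro sin_gt_zero) auto
  show "tan (x + d) - tan x < tan (y + d) - tan y"
    using diff[of x] diff[of y] assms m s mult_pos_pos[OF cy]
    by (simp add: divide_strict_left_mono)
qed

lemma cot_conv_tan: "cot x = tan (pi / 2 - x)" for x :: real
  by (simp add: cot_def tan_def sin_diff cos_diff)

text \<open>The angles of the second and third path add up to at most a right angle, so
  \<open>cot (b * \<psi>)\<close> outweighs \<open>tan (c * \<psi>)\<close>; the other two terms are
  positive.\<close>

lemma theta_anti_pos:
  assumes "a \<ge> 1" "b \<ge> 1" "0 < \<psi>" "\<psi> < pi / 2" "real a * \<psi> < pi / 2" "real b * \<psi> < pi / 2"
    and "real (b + c) * \<psi> \<le> pi / 2" "real c * \<psi> < pi / 2"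
  shows "theta_anti \<psi> a b c > 0"
proof -
  have "tan \<psi> > 0" "cot (a * \<psi>) > 0" using assms by (auto intro!: tan_gt_zero cot_gt_zero)
  moreover have "cot (b * \<psi>) \<ge> tan (c * \<psi>)"
    unfolding cot_conv_tan using assms 
    by (intro tan_mono_le) (auto simp: algebra_simps intro: less_le_trans[of _ 0])
  ultimately show ?thesis by (simp add: theta_anti_def)
qed

text \<open>Because n\<psi> is a right angle, cot c\<psi> = tan (a + b - 1)\<psi>. The pairs 1, a +
  b - 1 and a, b have the same sum and the first is the more spread out, so convexity gives the
  sign; it is strict if neither a nor b is 1.\<close>

lemma theta_sym_odd_order:
  assumes n: "a + b + c = n + 1" and len: "a \<ge> 1" "b \<ge> 1" "c \<ge> 1" and \<psi>: "\<psi> = pi / (2 * real n)"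
  shows "theta_sym \<psi> a b c \<ge> 0" and "a > 1 \<Longrightarrow> b > 1 \<Longrightarrow> theta_sym \<psi> a b c > 0"
proof -
  have n0: "n > 0" using n len by simp
  have pos: "\<psi> > 0" and np: "real n * \<psi> = pi / 2" using n0 by (simp_all add: \<psi>)
  have lt: "real m * \<psi> < pi / 2" if "m < n" for m
    using that pos unfolding np[symmetric] by simp
  have nr: "real n = real a + real b + real c - 1" using n by linarith
  have c: "cot (c * \<psi>) = tan (b * \<psi> + (real a - 1) * \<psi>)"
    unfolding cot_conv_tan np[symmetric] nr by (intro arg_cong[of _ _ tan]) (simp add: algebra_simps)
  have ab: "b * \<psi> + (real a - 1) * \<psi> < pi / 2"
    using lt[of "a + b - 1"] n len by (simp add: of_nat_diff algebra_simps)
  have eq: "\<psi> + (real a - 1) * \<psi> = a * \<psi>" by (simp add: algebra_simps)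
  have b: "\<psi> \<le> b * \<psi>" using pos len by simp
  have "tan (\<psi> + (real a - 1) * \<psi>) - tan \<psi> \<le> tan (b * \<psi> + (real a - 1) * \<psi>) - tan (b * \<psi>)"
    using ab b pos len by (intro tan_add_diff_mono(1)) auto
  then show "theta_sym \<psi> a b c \<ge> 0" unfolding theta_sym_def c eq by simp
  assume "a > 1" "b > 1"
  then have "tan (\<psi> + (real a - 1) * \<psi>) - tan \<psi> < tan (b * \<psi> + (real a - 1) * \<psi>) - tan (b * \<psi>)"
    using ab b pos len by (intro tan_add_diff_mono(2)) auto
  then show "theta_sym \<psi> a b c > 0" unfolding theta_sym_def c eq by simp
qed

text \<open>Comparison with the lengths 2, 2, n - 3 in two convexity steps: first a, b are spread to
  2, a + b - 2, then the increment over \<open>d\<close> at (a + b - 2)\<psi> is compared with that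
  at 2\<psi>. The second step is strict since a + b > 4, and the remaining expression is the root
  equation.\<close>

lemma theta_sym_even_order:
  assumes n: "a + b + c = n + 1" and len: "a \<ge> 2" "b \<ge> 2" "c \<ge> 1" and ab: "a + b > 4"
    and \<psi>: "0 < \<psi>" "real (n - 1) * \<psi> < pi / 2" and pi: "pi / 2 \<le> real n * \<psi>"
    and root: "theta_sym \<psi> 2 2 (n - 3) = 0"
  shows "theta_sym \<psi> a b c > 0"
proof -
  \<comment> \<open>The distance of (n - 1)\<psi> from the right angle; it turns the complement of
    c\<psi> into (a + b - 2)\<psi> + d.\<close>
  define d where "d = pi / 2 - real (n - 1) * \<psi>"
  have d: "d > 0" using \<psi> by (simp add: d_def)
  have "real n = real a + real b + real c - 1" using n by linarith
  then have nr: "real (n - 1) = real a + real b + real c - 2" "real (n - 3) = real (n - 1) - 2"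
    using n len by linarith+
  define s where "s = real a + real b - 2"
  have dd: "real c * \<psi> = pi / 2 - d - s * \<psi>" "(real (n - 1) - 2) * \<psi> = pi / 2 - d - 2 * \<psi>"
    unfolding d_def s_def nr by (simp_all add: algebra_simps)
  have c: "cot (c * \<psi>) = tan (s * \<psi> + d)" and c3: "cot (real (n - 3) * \<psi>) = tan (2 * \<psi> + d)"
    unfolding cot_conv_tan nr(2) dd by (simp_all add: add.commute)
  have cp: "real c * \<psi> > 0" using len \<psi> by simp
  then have lt: "s * \<psi> + d < pi / 2" using dd by linarith
  have s2: "2 * \<psi> < s * \<psi>" using ab \<psi> unfolding s_def by simp
  have 1: "tan (2 * \<psi> + d) - tan (2 * \<psi>) < tan (s * \<psi> + d) - tan (s * \<psi>)"
    using s2 \<psi> d lt by (intro tan_add_diff_mono(2)) auto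
  have e: "2 * \<psi> + (real a - 2) * \<psi> = a * \<psi>" "b * \<psi> + (real a - 2) * \<psi> = s * \<psi>"
    by (simp_all add: s_def algebra_simps)
  have "tan (2 * \<psi> + (real a - 2) * \<psi>) - tan (2 * \<psi>) \<le> tan (b * \<psi> + (real a - 2) * \<psi>) - tan (b * \<psi>)"
    using len \<psi> lt d by (intro tan_add_diff_mono(1)) (auto simp: e)
  then have 2: "tan (a * \<psi>) - tan (2 * \<psi>) \<le> tan (s * \<psi>) - tan (b * \<psi>)" unfolding e .
  have 3: "tan \<psi> - 2 * tan (2 * \<psi>) + tan (2 * \<psi> + d) = 0"
    using root unfolding theta_sym_def c3 by simp
  from 1 2 3 show ?thesis unfolding theta_sym_def c by linarith
qed

text \<open>Intermediate values between \<open>u\<close> with nu = pi / 2 and \<open>v\<close> with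
  (n - 1)v = pi / 2. At \<open>u\<close> the convexity estimate gives a positive sign; at
  \<open>v\<close> the cotangent is tan 2v, leaving tan v - tan 2v < 0.\<close>

lemma theta_sym_root_exists:
  assumes n: "n \<ge> 4"
  obtains \<psi> where "0 < \<psi>" "pi / 2 \<le> real n * \<psi>" "real (n - 1) * \<psi> < pi / 2" "theta_sym \<psi> 2 2 (n - 3) = 0"
proof -
  define u v where "u = pi / (2 * real n)" and "v = pi / (2 * (real n - 1))"
  have u0: "u > 0" and nu: "real n * u = pi / 2" and nv: "(real n - 1) * v = pi / 2"
    using n by (simp_all add: u_def v_def field_simps)
  have uv: "u < v" unfolding u_def v_def using n by (intro divide_strict_left_mono) auto
  have n3: "real (n - 3) = real n - 3" "real (n - 1) = real n - 1" using n by simp_all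
  \<comment> \<open>This is where n is at least 4; it keeps x and 2x away from the pole of the
    tangent on the whole interval.\<close>
  have v3: "3 * v \<le> pi / 2"
    unfolding nv[symmetric] using n u0 uv by (intro mult_right_mono) auto
  have "theta_sym u 2 2 (n - 3) > 0"
    using n theta_sym_odd_order(2)[of 2 2 "n - 3" n u] by (simp add: u_def)
  moreover have "theta_sym v 2 2 (n - 3) < 0"
  proof -
    have "cot (real (n - 3) * v) = tan (2 * v)"
      unfolding cot_conv_tan nv[symmetric] n3 by (simp add: algebra_simps)
    moreover have "tan v < tan (2 * v)" using u0 uv v3 by (intro tan_monotone) auto
    ultimately show ?thesis by (simp add: theta_sym_def)
  qed
  moreover have "continuous_on {u..v} (\<lambda>x. theta_sym x 2 2 (n - 3))"
  proof -
    have "cos x \<noteq> 0" "cos (2 * x) \<noteq> 0" "sin (real (n - 3) * x) \<noteq> 0" if x: "x \<in> {u..v}" for x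
    proof -
      have "x > 0" "3 * x \<le> pi / 2" using x u0 v3 by auto
      then have "cos x > 0" "cos (2 * x) > 0" by (auto intro!: cos_gt_zero_pi)
      moreover have "real (n - 3) * x \<le> (real n - 1) * v"
        unfolding n3 using x u0 n by (intro mult_mono) auto
      then have "sin (real (n - 3) * x) > 0"
        using \<open>x > 0\<close> n nv pi_gt_zero by (intro sin_gt_zero) (simp_all only: of_nat_0_less_iff zero_less_mult_iff, auto)
      ultimately show "cos x \<noteq> 0" "cos (2 * x) \<noteq> 0" "sin (real (n - 3) * x) \<noteq> 0" by auto
    qed
    then show ?thesis unfolding theta_sym_def tan_def cot_def
      by (auto intro!: continuous_intros)
  qed
  ultimately obtain x where x: "u \<le> x" "x \<le> v" "theta_sym x 2 2 (n - 3) = 0"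
    using IVT2'[of "\<lambda>x. theta_sym x 2 2 (n - 3)" v 0 u] uv by auto
  \<comment> \<open>Excluding the right end makes the bound on (n - 1)\<psi> strict.\<close>
  have "x \<noteq> v" using x \<open>theta_sym v 2 2 (n - 3) < 0\<close> by auto
  with x have "(real n - 1) * x < (real n - 1) * v" using n by (intro mult_strict_left_mono) auto
  moreover have "real n * u \<le> real n * x" using x by (intro mult_left_mono) auto
  ultimately show ?thesis using that[of x] x u0 nu nv n3 by auto
qed

subsection \<open>Eigenfunctions of the signless Laplacian\<close>

text \<open>The eigenvector equation of Q written at each vertex, free of an enumeration. The field
  is left open because an eigenvalue is first found over the complex numbers.\<close>

definition Q_eigenfunction :: "'a pair_pre_digraph \<Rightarrow> 'b::real_normed_field \<Rightarrow> ('a \<Rightarrow> 'b) \<Rightarrow> bool" where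
  "Q_eigenfunction G k x \<longleftrightarrow> (\<exists>w\<in>pverts G. x w \<noteq> 0) \<and>
     (\<forall>w\<in>pverts G. (\<Sum>z | (w, z) \<in> parcs G. x w + x z) = k * x w)"

lemma out_degree_with_proj: "out_degree (with_proj G) w = card {z. (w, z) \<in> parcs G}"
proof -
  have "out_arcs (with_proj G) w = Pair w ` {z. (w, z) \<in> parcs G}"
    by (auto simp: out_arcs_def)
  then show ?thesis by (simp add: out_degree_def card_image inj_on_def)
qed

lemma spectrum_signless_laplacian_iff:
  assumes "pair_fin_digraph G" and f: "bij_betw f {..<card (pverts G)} (pverts G)"
  shows "(k::'b::real_normed_field) \<in> spectrum (map_mat of_real (signless_laplacian f G))
    \<longleftrightarrow> (\<exists>x. Q_eigenfunction G k x)"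
proof -
  interpret pair_fin_digraph G by fact
  define n where "n = card (pverts G)"
  let ?A = "map_mat of_real (signless_laplacian f G) :: 'b mat"
  have dims: "dim_row (signless_laplacian f G) = n" "dim_col (signless_laplacian f G) = n"
    by (simp_all add: signless_laplacian_def adjacency_matrix_def degree_matrix_def Let_def n_def)
  have fV: "f i \<in> pverts G" if "i < n" for i
    using f that by (auto simp: bij_betw_def n_def)
  have inj: "f i = f j \<longleftrightarrow> i = j" if "i < n" "j < n" for i j
    using f that by (auto simp: bij_betw_def n_def inj_on_def)
  have fin: "finite {z. (w, z) \<in> parcs G}" for w
    by (rule finite_subset[OF _ pair_finite_verts]) (auto dest: in_arcsD2)
  \<comment> \<open>The diagonal entry is the number of neighbours, so it supplies one
    \<open>x (f i)\<close> to each summand on the right.\<close>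
  have row: "(\<Sum>j<n. ?A $$ (i, j) * x (f j)) = (\<Sum>z | (f i, z) \<in> parcs G. x (f i) + x z)"
    if i: "i < n" for i and x :: "'a \<Rightarrow> 'b"
  proof -
    have entry: "?A $$ (i, j) * x (f j) = (if i = j then of_nat (card {z. (f i, z) \<in> parcs G}) * x (f i) else 0)
        + (if (f i, f j) \<in> parcs G then x (f j) else 0)" if "j < n" for j
      using i that
      by (simp add: signless_laplacian_def adjacency_matrix_def degree_matrix_def Let_def n_def[symmetric]
          out_degree_with_proj distrib_right)
    have "(\<Sum>j<n. ?A $$ (i, j) * x (f j)) = of_nat (card {z. (f i, z) \<in> parcs G}) * x (f i)
        + (\<Sum>j<n. if (f i, f j) \<in> parcs G then x (f j) else 0)"
      using i by (simp add: entry sum.distrib)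
    also have "(\<Sum>j<n. if (f i, f j) \<in> parcs G then x (f j) else 0)
        = (\<Sum>z\<in>pverts G. if (f i, z) \<in> parcs G then x z else 0)"
      using sum.reindex_bij_betw[OF f, of "\<lambda>z. if (f i, z) \<in> parcs G then x z else 0"]
      by (simp add: n_def)
    also have "\<dots> = (\<Sum>z | (f i, z) \<in> parcs G. x z)"
      by (subst sum.inter_filter[symmetric])
        (auto simp: pair_finite_verts dest: in_arcsD2 intro!: sum.cong)
    finally show ?thesis by (simp add: sum.distrib)
  qed
  show ?thesis
  proof
    assume "k \<in> spectrum ?A"
    then obtain v where v: "v \<in> carrier_vec n" "v \<noteq> 0\<^sub>v n" "?A *\<^sub>v v = k \<cdot>\<^sub>v v"
      by (auto simp: spectrum_def eigenvalue_def eigenvector_def dims)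
    define x where "x = (\<lambda>w. v $ the_inv_into {..<n} f w)"
    have xf: "x (f i) = v $ i" if "i < n" for i
      using that f by (simp add: x_def n_def bij_betw_def the_inv_into_f_f)
    from v(1,2) obtain i where i: "i < n" "v $ i \<noteq> 0" by (auto simp: vec_eq_iff)
    have "(\<Sum>z | (w, z) \<in> parcs G. x w + x z) = k * x w" if "w \<in> pverts G" for w
    proof -
      from that f obtain i where i: "i < n" "w = f i" unfolding bij_betw_def n_def by auto
      have "(\<Sum>j<n. ?A $$ (i, j) * x (f j)) = (?A *\<^sub>v v) $ i"
        using i v(1) by (simp add: scalar_prod_def dims xf atLeast0LessThan)
      also have "\<dots> = k * x w" using i v(1) by (simp add: v(3) xf)
      finally show ?thesis using row[OF i(1), of x] i(2) by simp
    qed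
    then show "\<exists>x. Q_eigenfunction G k x"
      unfolding Q_eigenfunction_def using i fV xf by metis
  next
    assume "\<exists>x. Q_eigenfunction G k x"
    then obtain x w where x: "w \<in> pverts G" "x w \<noteq> 0"
      "\<And>w. w \<in> pverts G \<Longrightarrow> (\<Sum>z | (w, z) \<in> parcs G. x w + x z) = k * x w"
      unfolding Q_eigenfunction_def by blast
    define v where "v = vec n (\<lambda>i. x (f i))"
    from x(1) f obtain i where i: "i < n" "w = f i" unfolding bij_betw_def n_def by auto
    have "v \<noteq> 0\<^sub>v n" using i x(2) by (auto simp: v_def vec_eq_iff)
    moreover have "?A *\<^sub>v v = k \<cdot>\<^sub>v v"
    proof (rule eq_vecI)
      fix i assume "i < dim_vec (k \<cdot>\<^sub>v v)"
      then have i: "i < n" by (simp add: v_def)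
      have "(?A *\<^sub>v v) $ i = (\<Sum>j<n. ?A $$ (i, j) * x (f j))"
        using i by (simp add: scalar_prod_def dims v_def atLeast0LessThan)
      then show "(?A *\<^sub>v v) $ i = (k \<cdot>\<^sub>v v) $ i"
        using row[OF i, of x] x(3)[OF fV[OF i]] i by (simp add: v_def)
    qed (simp add: v_def dims)
    ultimately show "k \<in> spectrum ?A"
      by (auto simp: spectrum_def eigenvalue_def eigenvector_def dims v_def intro!: exI[of _ v])
  qed
qed

lemma spectrum_signless_laplacian_real_iff:
  assumes "pair_fin_digraph G" and "bij_betw f {..<card (pverts G)} (pverts G)"
  shows "k \<in> spectrum (signless_laplacian f G) \<longleftrightarrow> (\<exists>x. Q_eigenfunction G k x)"
proof -
  have "map_mat of_real (signless_laplacian f G) = signless_laplacian f G"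
    by (rule eq_matI) auto
  then show ?thesis using spectrum_signless_laplacian_iff[OF assms, of k] by simp
qed

text \<open>Each edge lies in \<open>parcs G\<close> in both orientations; exchanging them replaces
  the factor \<open>y w\<close> by \<open>y z\<close>, and the two halves add up. The separate
  \<open>y\<close> allows the conjugate of \<open>x\<close> in the complex case.\<close>

lemma Q_bilinear_form:
  fixes x y :: "'a \<Rightarrow> 'b::comm_ring_1"
  assumes "pair_pseudo_graph G"
  shows "2 * (\<Sum>w\<in>pverts G. y w * (\<Sum>z | (w, z) \<in> parcs G. x w + x z))
     = (\<Sum>(w, z)\<in>parcs G. (y w + y z) * (x w + x z))"
proof -
  interpret pair_pseudo_graph G by fact
  have S: "parcs G = (SIGMA w:pverts G. {z. (w, z) \<in> parcs G})"
    by (auto dest: in_arcsD1)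
  have fin: "finite {z. (w, z) \<in> parcs G}" for w
    by (rule finite_subset[OF _ pair_finite_verts]) (auto dest: in_arcsD2)
  have "(\<Sum>w\<in>pverts G. y w * (\<Sum>z | (w, z) \<in> parcs G. g w z)) = (\<Sum>(w, z)\<in>parcs G. y w * g w z)" for g
    by (subst (2) S) (simp add: sum.Sigma[symmetric] pair_finite_verts fin sum_distrib_left)
  from this[of "\<lambda>w z. x w + x z"]
  have "(\<Sum>w\<in>pverts G. y w * (\<Sum>z | (w, z) \<in> parcs G. x w + x z)) = (\<Sum>(w, z)\<in>parcs G. y w * (x w + x z))" .
  moreover have "(\<Sum>(w, z)\<in>parcs G. y w * (x w + x z)) = (\<Sum>(w, z)\<in>parcs G. y z * (x w + x z))"
    by (rule sum.reindex_bij_witness[of _ prod.swap prod.swap])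
      (auto simp: add.commute intro: arcs_symmetric)
  moreover have "(\<Sum>(w, z)\<in>parcs G. (y w + y z) * (x w + x z))
      = (\<Sum>(w, z)\<in>parcs G. y w * (x w + x z)) + (\<Sum>(w, z)\<in>parcs G. y z * (x w + x z))"
    by (simp only: case_prod_unfold distrib_right[of "y _"] sum.distrib)
  ultimately show ?thesis by (simp only: mult_2)
qed

lemma Q_eigenfunction_energy:
  fixes x :: "'a \<Rightarrow> real"
  assumes "pair_pseudo_graph G" "Q_eigenfunction G k x"
  shows "2 * k * (\<Sum>w\<in>pverts G. (x w)\<^sup>2) = (\<Sum>(w, z)\<in>parcs G. (x w + x z)\<^sup>2)"
proof -
  have "(\<Sum>w\<in>pverts G. x w * (\<Sum>z | (w, z) \<in> parcs G. x w + x z)) = (\<Sum>w\<in>pverts G. x w * (k * x w))"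
    using assms(2) unfolding Q_eigenfunction_def by (intro sum.cong) metis+
  then show ?thesis
    using Q_bilinear_form[OF assms(1), of x x] by (simp add: power2_eq_square sum_distrib_left mult_ac)
qed

text \<open>Pairing the equation with the conjugate of \<open>x\<close> shows that \<open>k\<close>
  times a positive number is real, so \<open>k\<close> is real. Real and imaginary parts then
  satisfy the equation separately, and one of them is nonzero.\<close>

lemma Q_eigenfunction_complex_imp_real:
  fixes x :: "'a \<Rightarrow> complex"
  assumes "pair_pseudo_graph G" "Q_eigenfunction G k x"
  shows "\<exists>y::'a \<Rightarrow> real. Q_eigenfunction G (Re k) y"
proof -
  interpret pair_pseudo_graph G by fact
  from assms(2) obtain w where w: "w \<in> pverts G" "x w \<noteq> 0"
    and eq: "\<And>w. w \<in> pverts G \<Longrightarrow> (\<Sum>z | (w, z) \<in> parcs G. x w + x z) = k * x w"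
    unfolding Q_eigenfunction_def by blast
  define r where "r = (\<Sum>w\<in>pverts G. (cmod (x w))\<^sup>2)"
  have "r > 0" unfolding r_def using w
    by (intro sum_pos2[of _ w]) (auto simp: pair_finite_verts)
  have "2 * (\<Sum>w\<in>pverts G. cnj (x w) * (k * x w)) = (\<Sum>(w, z)\<in>parcs G. cnj (x w + x z) * (x w + x z))"
    using Q_bilinear_form[OF assms(1), of "\<lambda>w. cnj (x w)" x]
    unfolding complex_cnj_add by (subst sum.cong[OF refl arg_cong[OF eq[symmetric]]]) auto
  moreover have "(\<Sum>w\<in>pverts G. cnj (x w) * (k * x w)) = k * of_real r"
    unfolding r_def by (simp add: sum_distrib_left complex_norm_square[symmetric] mult_ac)
  moreover have "(\<Sum>(w, z)\<in>parcs G. cnj (x w + x z) * (x w + x z))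
      = of_real (\<Sum>(w, z)\<in>parcs G. (cmod (x w + x z))\<^sup>2)"
    by (simp only: of_real_sum case_prod_unfold complex_norm_square mult.commute)
  ultimately have "2 * (k * of_real r) = of_real (\<Sum>(w, z)\<in>parcs G. (cmod (x w + x z))\<^sup>2)" by simp
  from arg_cong[OF this, of Im] have k: "Im k = 0" using \<open>r > 0\<close> by simp
  have "Q_eigenfunction G (Re k) (\<lambda>w. Re (x w))" if "Re (x w) \<noteq> 0"
    unfolding Q_eigenfunction_def using that w(1) arg_cong[OF eq, of _ Re] k by auto
  moreover have "Q_eigenfunction G (Re k) (\<lambda>w. Im (x w))" if "Im (x w) \<noteq> 0"
    unfolding Q_eigenfunction_def using that w(1) arg_cong[OF eq, of _ Im] k by auto
  moreover have "Re (x w) \<noteq> 0 \<or> Im (x w) \<noteq> 0" using w(2) by (auto simp: complex_eq_iff)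
  ultimately show ?thesis by blast
qed

text \<open>\<open>Min\<close> is meaningful only on a finite nonempty set. The complexified matrix
  has an eigenvalue, and its reality makes the real spectrum nonempty.\<close>

lemma
  fixes k :: real and x :: "'a \<Rightarrow> real"
  assumes "pair_pseudo_graph G" and "pverts G \<noteq> {}"
  shows least_Q_eigenvalue_attained: "\<exists>x. Q_eigenfunction G (least_Q_eigenvalue G) x"
    and least_Q_eigenvalue_le: "Q_eigenfunction G k x \<Longrightarrow> least_Q_eigenvalue G \<le> k"
proof -
  interpret pair_pseudo_graph G by fact
  have fd: "pair_fin_digraph G" by unfold_locales
  from ex_bij_betw_nat_finite[OF pair_finite_verts] obtain f
    where f: "bij_betw f {..<card (pverts G)} (pverts G)" by (auto simp: atLeast0LessThan)
  let ?A = "signless_laplacian f G" and ?n = "card (pverts G)"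
  have A: "?A \<in> carrier_mat ?n ?n"
    by (auto simp: signless_laplacian_def adjacency_matrix_def degree_matrix_def Let_def)
  have q: "least_Q_eigenvalue G = Min (spectrum ?A)" by (rule least_Q_eigenvalue_enum[OF f])
  have fin: "finite (spectrum ?A)" by (rule card_finite_spectrum(1)[OF A])
  have "?n \<noteq> 0" using assms(2) pair_finite_verts by simp
  with A have "spectrum (map_mat complex_of_real ?A) \<noteq> {}"
    by (intro spectrum_non_empty[of _ ?n]) auto
  then obtain z y where "Q_eigenfunction G (z::complex) y"
    using spectrum_signless_laplacian_iff[OF fd f, where ?'b = complex] by auto
  from Q_eigenfunction_complex_imp_real[OF assms(1) this] have "spectrum ?A \<noteq> {}"
    using spectrum_signless_laplacian_real_iff[OF fd f] by auto
  from Min_in[OF fin this] show "\<exists>x. Q_eigenfunction G (least_Q_eigenvalue G) x"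
    unfolding q spectrum_signless_laplacian_real_iff[OF fd f] .
  show "least_Q_eigenvalue G \<le> k" if "Q_eigenfunction G k x"
    unfolding q using that spectrum_signless_laplacian_real_iff[OF fd f] by (intro Min_le fin) auto
qed

subsection \<open>Presentations by three paths\<close>

text \<open>The lists hold the interior vertices, so a path has one edge more than its list has
  entries, and all disjointness becomes a single \<open>distinct\<close>. Distinctness of the three
  lists allows at most one of them to be empty, that is, at most one path is the edge uv.\<close>

definition theta_presentation ::
  "'a pair_pre_digraph \<Rightarrow> 'a \<Rightarrow> 'a \<Rightarrow> 'a list \<Rightarrow> 'a list \<Rightarrow> 'a list \<Rightarrow> bool" where
  "theta_presentation G u v ps qs rs \<longleftrightarrow> distinct (u # v # ps @ qs @ rs) \<and> distinct [ps, qs, rs] \<and>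
     pverts G = set (u # v # ps @ qs @ rs) \<and>
     parcs G = symcl (set (vwalk_arcs (u # ps @ [v])) \<union> set (vwalk_arcs (u # qs @ [v]))
       \<union> set (vwalk_arcs (u # rs @ [v])))"

lemma theta_presentation_swap12:
  "theta_presentation G u v ps qs rs \<Longrightarrow> theta_presentation G u v qs ps rs"
  unfolding theta_presentation_def
    Un_commute[of "set (vwalk_arcs (u # ps @ [v]))" "set (vwalk_arcs (u # qs @ [v]))"]
  by (auto simp del: vwalk_arcs_Cons)

lemma theta_presentation_swap23:
  "theta_presentation G u v ps qs rs \<Longrightarrow> theta_presentation G u v ps rs qs"
  unfolding theta_presentation_def Un_assoc Un_commute[of "set (vwalk_arcs (u # rs @ [v]))"]
  by (auto simp del: vwalk_arcs_Cons)

lemma theta_presentation_exists: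
  assumes "theta_graph G"
  obtains u v ps qs rs where "theta_presentation G u v ps qs rs"
proof -
  from assms obtain u v p q r where uv: "u \<noteq> v"
    and "path_between G u p v" "path_between G u q v" "path_between G u r v"
    and d: "distinct [p, q, r]"
    and int: "internal_verts p \<inter> internal_verts q = {}" "internal_verts p \<inter> internal_verts r = {}"
      "internal_verts q \<inter> internal_verts r = {}"
    and G: "pverts G = set p \<union> set q \<union> set r"
      "parcs G = symcl (set (vwalk_arcs p) \<union> set (vwalk_arcs q) \<union> set (vwalk_arcs r))"
    unfolding theta_graph_def by blast
  have "\<exists>m. s = u # m @ [v] \<and> distinct s" if "path_between G u s v" for s
  proof -
    have "s \<noteq> []" "distinct s" "hd s = u" "last s = v"
      using that by (auto simp: path_between_def vpath_def vwalk_def)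
    moreover have "tl s \<noteq> []" using calculation uv by (cases s) auto
    ultimately show ?thesis
      by (intro exI[of _ "butlast (tl s)"]) (metis append_butlast_last_id last_tl list.collapse)
  qed
  then obtain ps qs rs where s: "p = u # ps @ [v]" "q = u # qs @ [v]" "r = u # rs @ [v]"
    and ds: "distinct p" "distinct q" "distinct r"
    using \<open>path_between G u p v\<close> \<open>path_between G u q v\<close> \<open>path_between G u r v\<close> by metis
  have "theta_presentation G u v ps qs rs"
    unfolding theta_presentation_def using uv d ds int G unfolding s
    by (auto simp: internal_verts_def)
  then show ?thesis by (rule that)
qed

lemma vwalk_arcs_conv_nth: "vwalk_arcs s = map (\<lambda>k. (s ! k, s ! Suc k)) [0..<length s - 1]"
proof (induction s rule: vwalk_arcs.induct)
  case (3 x y s)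
  have "map (\<lambda>k. ((x # y # s) ! k, (x # y # s) ! Suc k)) [0..<Suc (length s)]
    = (x, y) # map (\<lambda>k. ((y # s) ! k, (y # s) ! Suc k)) [0..<length s]"
    by (subst upt_conv_Cons) (auto simp: map_Suc_upt[symmetric] simp del: upt_Suc)
  with 3 show ?case by simp
qed auto

lemma vwalk_arcs_map: "vwalk_arcs (map h s) = map (map_prod h h) (vwalk_arcs s)"
  by (induction s rule: vwalk_arcs.induct) auto

lemma in_set_vwalk_arcs_iff:
  "(y, z) \<in> set (vwalk_arcs s) \<longleftrightarrow> (\<exists>k. Suc k < length s \<and> y = s ! k \<and> z = s ! Suc k)"
  by (auto simp: vwalk_arcs_conv_nth less_diff_conv)

lemma sum_vwalk_arcs:
  assumes "distinct s"
  shows "(\<Sum>e\<in>set (vwalk_arcs s). g e) = (\<Sum>k<length s - 1. g (s ! k, s ! Suc k))"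
proof -
  have "set (vwalk_arcs s) = (\<lambda>k. (s ! k, s ! Suc k)) ` {..<length s - 1}"
    by (auto simp: vwalk_arcs_conv_nth)
  moreover have "inj_on (\<lambda>k. (s ! k, s ! Suc k)) {..<length s - 1}"
    using assms by (auto simp: inj_on_def nth_eq_iff_index_eq)
  ultimately show ?thesis by (simp add: sum.reindex)
qed

text \<open>Path arcs are directed from \<open>u\<close> to \<open>v\<close>. These facts are what
  separates the arc sets of the three paths from each other and from their reversals.\<close>

lemma in_path_arcsD:
  assumes "(y, z) \<in> set (vwalk_arcs (u # m @ [v]))" and d: "distinct (u # m @ [v])"
  shows "y = u \<or> y \<in> set m" and "z = v \<or> z \<in> set m" and "y = u \<Longrightarrow> z = v \<Longrightarrow> m = []"
    and "(z, y) \<notin> set (vwalk_arcs (u # m @ [v]))"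
proof -
  let ?s = "u # m @ [v]"
  from assms obtain k where k: "Suc k < length ?s" "y = ?s ! k" "z = ?s ! Suc k"
    unfolding in_set_vwalk_arcs_iff by blast
  show "y = u \<or> y \<in> set m" using k by (cases k) (auto simp: nth_append)
  show "z = v \<or> z \<in> set m" using k by (auto simp: nth_append)
  show "m = []" if "y = u" "z = v"
  proof -
    have "k = 0" using k d that nth_eq_iff_index_eq[OF d, of k 0] by simp
    then have "?s ! Suc 0 = ?s ! Suc (length m)" using k that by (simp add: nth_append)
    then show ?thesis using nth_eq_iff_index_eq[OF d, of "Suc 0" "Suc (length m)"] by simp
  qed
  show "(z, y) \<notin> set (vwalk_arcs ?s)"
  proof
    assume "(z, y) \<in> set (vwalk_arcs ?s)"
    then obtain j where j: "Suc j < length ?s" "z = ?s ! j" "y = ?s ! Suc j"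
      unfolding in_set_vwalk_arcs_iff by blast
    have "k = Suc j" "Suc k = j"
      using nth_eq_iff_index_eq[OF d, of k "Suc j"] nth_eq_iff_index_eq[OF d, of "Suc k" j] k j by auto
    then show False by simp
  qed
qed

text \<open>The three directed arc sets and their three reversals partition \<open>parcs G\<close>,
  and \<open>g\<close> has the same sum over a set and its reversal.\<close>

lemma theta_presentation_sum_arcs:
  fixes g :: "'a \<times> 'a \<Rightarrow> real"
  assumes G: "theta_presentation G u v ps qs rs" and sym: "\<And>y z. g (y, z) = g (z, y)"
  shows "(\<Sum>e\<in>parcs G. g e) = 2 * ((\<Sum>e\<in>set (vwalk_arcs (u # ps @ [v])). g e)
    + (\<Sum>e\<in>set (vwalk_arcs (u # qs @ [v])). g e) + (\<Sum>e\<in>set (vwalk_arcs (u # rs @ [v])). g e))"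
proof -
  define A where "A = (\<lambda>m. set (vwalk_arcs (u # m @ [v])))"
  have dist: "distinct (u # v # ps @ qs @ rs)" "distinct [ps, qs, rs]"
    and arcs: "parcs G = symcl (A ps \<union> A qs \<union> A rs)"
    using G by (auto simp: theta_presentation_def A_def)
  have AD: "y = u \<or> y \<in> set m" "z = v \<or> z \<in> set m" "y = u \<Longrightarrow> z = v \<Longrightarrow> m = []"
    if "(y, z) \<in> A m" "distinct (u # v # m)" for y z m
  proof -
    have d: "distinct (u # m @ [v])" using that(2) by auto
    note D = in_path_arcsD[OF that(1)[unfolded A_def] d]
    show "y = u \<or> y \<in> set m" by (rule D(1))
    show "z = v \<or> z \<in> set m" by (rule D(2))
    show "y = u \<Longrightarrow> z = v \<Longrightarrow> m = []" by (rule D(3))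
  qed
  \<comment> \<open>A common arc would have to be (u, v), which makes both interiors empty and hence
    equal. A reversed arc would start in the interior of \<open>m'\<close> or at \<open>u\<close>
    but end an arc of \<open>m\<close>, where only its interior and \<open>v\<close> are
    available.\<close>
  have disj: "A m \<inter> A m' = {} \<and> A m \<inter> prod.swap ` A m' = {}"
    if "m \<noteq> m'" "distinct (u # v # m @ m')" for m m'
  proof -
    have d: "distinct (u # v # m)" "distinct (u # v # m')" using that by auto
    have ne: "u \<noteq> v" "u \<notin> set m" "u \<notin> set m'" "v \<notin> set m" "v \<notin> set m'" "set m \<inter> set m' = {}"
      using that by auto
    have "(y, z) \<notin> A m'" if "(y, z) \<in> A m" for y z
      using AD[OF that d(1)] AD[OF _ d(2), of y z] ne \<open>m \<noteq> m'\<close> by blast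
    moreover have "(z, y) \<notin> A m'" if "(y, z) \<in> A m" for y z
      using AD[OF that d(1)] AD[OF _ d(2), of z y] ne by blast
    ultimately show ?thesis by auto
  qed
  have self: "A m \<inter> prod.swap ` A m = {}" if "distinct (u # v # m)" for m
  proof -
    have "(z, y) \<notin> A m" if "(y, z) \<in> A m" for y z
    proof -
      have "distinct (u # m @ [v])" using \<open>distinct (u # v # m)\<close> by auto
      then show ?thesis unfolding A_def by (rule in_path_arcsD(4)[OF that[unfolded A_def]])
    qed
    then show ?thesis by auto
  qed
  have sep: "A ps \<inter> A qs = {}" "A ps \<inter> A rs = {}" "A qs \<inter> A rs = {}"
    "A ps \<inter> prod.swap ` A qs = {}" "A ps \<inter> prod.swap ` A rs = {}" "A qs \<inter> prod.swap ` A ps = {}"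
    "A qs \<inter> prod.swap ` A rs = {}" "A rs \<inter> prod.swap ` A ps = {}" "A rs \<inter> prod.swap ` A qs = {}"
    "A ps \<inter> prod.swap ` A ps = {}" "A qs \<inter> prod.swap ` A qs = {}" "A rs \<inter> prod.swap ` A rs = {}"
  proof -
    have d: "distinct (u # v # ps @ qs)" "distinct (u # v # ps @ rs)" "distinct (u # v # qs @ rs)"
      "distinct (u # v # qs @ ps)" "distinct (u # v # rs @ ps)" "distinct (u # v # rs @ qs)"
      "distinct (u # v # ps)" "distinct (u # v # qs)" "distinct (u # v # rs)"
      and ne: "ps \<noteq> qs" "ps \<noteq> rs" "qs \<noteq> rs"
      using dist by auto
    show "A ps \<inter> A qs = {}" "A ps \<inter> prod.swap ` A qs = {}" using disj[OF ne(1) d(1)] by blast+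
    show "A ps \<inter> A rs = {}" "A ps \<inter> prod.swap ` A rs = {}" using disj[OF ne(2) d(2)] by blast+
    show "A qs \<inter> A rs = {}" "A qs \<inter> prod.swap ` A rs = {}" using disj[OF ne(3) d(3)] by blast+
    show "A qs \<inter> prod.swap ` A ps = {}" using disj[OF ne(1)[symmetric] d(4)] by blast
    show "A rs \<inter> prod.swap ` A ps = {}" using disj[OF ne(2)[symmetric] d(5)] by blast
    show "A rs \<inter> prod.swap ` A qs = {}" using disj[OF ne(3)[symmetric] d(6)] by blast
    show "A ps \<inter> prod.swap ` A ps = {}" by (rule self[OF d(7)])
    show "A qs \<inter> prod.swap ` A qs = {}" by (rule self[OF d(8)])
    show "A rs \<inter> prod.swap ` A rs = {}" by (rule self[OF d(9)])
  qed
  have fin: "finite (A m)" for m by (simp add: A_def)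
  let ?B = "A ps \<union> A qs \<union> A rs"
  have "(\<Sum>e\<in>parcs G. g e) = (\<Sum>e\<in>?B. g e) + (\<Sum>e\<in>prod.swap ` ?B. g e)"
  proof -
    have "parcs G = ?B \<union> prod.swap ` ?B"
      unfolding arcs symcl_def by (auto simp: prod.swap_def case_prod_unfold)
    moreover have "?B \<inter> prod.swap ` ?B = {}" 
      unfolding image_Un Int_Un_distrib Int_Un_distrib2 sep by simp
    ultimately show ?thesis using fin by (simp add: sum.union_disjoint)
  qed
  also have "(\<Sum>e\<in>prod.swap ` ?B. g e) = (\<Sum>e\<in>?B. g e)"
    by (subst sum.reindex) (auto intro!: sum.cong simp: sym)
  also have "(\<Sum>e\<in>?B. g e) = (\<Sum>e\<in>A ps. g e) + (\<Sum>e\<in>A qs. g e) + (\<Sum>e\<in>A rs. g e)"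
    using sep fin by (simp add: sum.union_disjoint Int_Un_distrib2)
  finally show ?thesis by (simp add: A_def)
qed

section \<open>Energy of an eigenfunction along the three paths\<close>

text \<open>Alternating the signs along a path turns the terms \<open>x w + x z\<close> of the signless form
  into differences.\<close>

definition alternating :: "('a \<Rightarrow> real) \<Rightarrow> 'a list \<Rightarrow> nat \<Rightarrow> real" where
  "alternating x s k = (-1) ^ k * x (s ! k)"

lemma path_energy_alternating:
  assumes "distinct (u # m @ [v])"
  shows "path_energy q (Suc (length m)) (alternating x (u # m @ [v]))
     = (\<Sum>(w, z)\<in>set (vwalk_arcs (u # m @ [v])). (x w + x z)\<^sup>2) - q * (\<Sum>w\<in>set m. (x w)\<^sup>2)"
proof -
  let ?s = "u # m @ [v]"
  have 1: "(alternating x ?s k - alternating x ?s (Suc k))\<^sup>2 = (x (?s ! k) + x (?s ! Suc k))\<^sup>2" for k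
  proof -
    have "alternating x ?s k - alternating x ?s (Suc k) = (-1) ^ k * (x (?s ! k) + x (?s ! Suc k))"
      by (simp add: alternating_def algebra_simps)
    then show ?thesis by (simp add: power_mult_distrib flip: power_mult)
  qed
  have 2: "(alternating x ?s k)\<^sup>2 = (x (?s ! k))\<^sup>2" for k
    by (simp add: alternating_def power_mult_distrib flip: power_mult)
  have "(\<Sum>k\<in>{0<..<Suc (length m)}. (x (?s ! k))\<^sup>2) = (\<Sum>k<length m. (x (m ! k))\<^sup>2)"
    by (rule sum.reindex_bij_witness[of _ Suc "\<lambda>k. k - 1"]) (auto simp: nth_append)
  also have "\<dots> = (\<Sum>w\<in>set m. (x w)\<^sup>2)"
    using assms sum.reindex_bij_betw[OF bij_betw_nth[of m "{..<length m}" "set m"], of "\<lambda>w. (x w)\<^sup>2"] by simp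
  finally show ?thesis
    unfolding path_energy_def 1 2 using sum_vwalk_arcs[OF assms, of "\<lambda>(w, z). (x w + x z)\<^sup>2"] by simp
qed

text \<open>The edge terms of the three paths sum to k times the squared norm, and interior and
  branch vertices together cover every vertex once in the subtraction of q times the norm. A lower
  bound for the left side thus decides the sign of k - q.\<close>

lemma theta_energy_eq:
  fixes x :: "'a \<Rightarrow> real"
  assumes G: "theta_presentation G u v ps qs rs" "pair_pseudo_graph G" and x: "Q_eigenfunction G k x"
  shows "path_energy q (Suc (length ps)) (alternating x (u # ps @ [v]))
     + path_energy q (Suc (length qs)) (alternating x (u # qs @ [v]))
     + path_energy q (Suc (length rs)) (alternating x (u # rs @ [v])) - q * ((x u)\<^sup>2 + (x v)\<^sup>2)
    = (k - q) * (\<Sum>w\<in>pverts G. (x w)\<^sup>2)"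
proof -
  have d: "distinct (u # v # ps @ qs @ rs)" using G(1) by (simp add: theta_presentation_def)
  then have d1: "distinct (u # ps @ [v])" "distinct (u # qs @ [v])" "distinct (u # rs @ [v])" by auto
  have "pverts G = {u, v} \<union> (set ps \<union> (set qs \<union> set rs))"
    using G(1) by (simp add: theta_presentation_def)
  then have "(\<Sum>w\<in>pverts G. (x w)\<^sup>2) = (\<Sum>w\<in>{u, v} \<union> (set ps \<union> (set qs \<union> set rs)). (x w)\<^sup>2)" by simp
  also have "\<dots> = (x u)\<^sup>2 + (x v)\<^sup>2 + (\<Sum>w\<in>set ps. (x w)\<^sup>2) + (\<Sum>w\<in>set qs. (x w)\<^sup>2) + (\<Sum>w\<in>set rs. (x w)\<^sup>2)"
    using d by (subst sum.union_disjoint, simp, simp, fastforce)+ auto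
  finally have V: "(\<Sum>w\<in>pverts G. (x w)\<^sup>2)
    = (x u)\<^sup>2 + (x v)\<^sup>2 + (\<Sum>w\<in>set ps. (x w)\<^sup>2) + (\<Sum>w\<in>set qs. (x w)\<^sup>2) + (\<Sum>w\<in>set rs. (x w)\<^sup>2)" .
  have "k * (\<Sum>w\<in>pverts G. (x w)\<^sup>2)
    = (\<Sum>(w, z)\<in>set (vwalk_arcs (u # ps @ [v])). (x w + x z)\<^sup>2)
    + (\<Sum>(w, z)\<in>set (vwalk_arcs (u # qs @ [v])). (x w + x z)\<^sup>2)
    + (\<Sum>(w, z)\<in>set (vwalk_arcs (u # rs @ [v])). (x w + x z)\<^sup>2)"
    using Q_eigenfunction_energy[OF G(2) x]
      theta_presentation_sum_arcs[OF G(1), of "\<lambda>(w, z). (x w + x z)\<^sup>2"]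
    by (simp add: add.commute)
  then show ?thesis
    unfolding path_energy_alternating[OF d1(1)] path_energy_alternating[OF d1(2)]
      path_energy_alternating[OF d1(3)] left_diff_distrib by (simp add: V algebra_simps)
qed

text \<open>With both coefficients nonnegative the energy is nonnegative, so k - q is. If k = q and
  both are positive, the branch values vanish, and then the Dirichlet lemma annihilates the
  eigenfunction on every path.\<close>

lemma theta_eigenvalue_bounds:
  fixes x :: "'a \<Rightarrow> real"
  assumes G: "theta_presentation G u v ps qs rs" "pair_pseudo_graph G" and x: "Q_eigenfunction G k x"
    and abc: "a = Suc (length ps)" "b = Suc (length qs)" "c = Suc (length rs)"
    and par: "even a \<longleftrightarrow> even b" "even a \<longleftrightarrow> odd c"
    and \<psi>: "0 < \<psi>" "\<psi> < pi / 2"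
    and lt: "real a * \<psi> < pi / 2" "real b * \<psi> < pi / 2" "real c * \<psi> < pi / 2"
    and anti: "theta_anti \<psi> a b c > 0"
  shows "theta_sym \<psi> a b c \<ge> 0 \<Longrightarrow> 4 * (sin \<psi>)\<^sup>2 \<le> k"
    and "theta_sym \<psi> a b c > 0 \<Longrightarrow> 4 * (sin \<psi>)\<^sup>2 < k"
proof -
  \<comment> \<open>\<open>Y\<close> carries the sign with which the alternation reaches
    \<open>v\<close> on the first two paths; the opposite parity of the third turns it into
    \<open>- Y\<close> there.\<close>
  define q X Y where "q = 4 * (sin \<psi>)\<^sup>2" and "X = x u" and "Y = (-1) ^ a * x v"
  define f g h where "f = alternating x (u # ps @ [v])" and "g = alternating x (u # qs @ [v])"
    and "h = alternating x (u # rs @ [v])"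
  define S where "S = (\<Sum>w\<in>pverts G. (x w)\<^sup>2)"
  have ge1: "a \<ge> 1" "b \<ge> 1" "c \<ge> 1" by (simp_all add: abc)
  have ends: "f a = Y" "g b = Y" "h c = - Y" "f 0 = X" "g 0 = X" "h 0 = X"
    using par by (auto simp: f_def g_def h_def alternating_def X_def Y_def abc nth_append)
  have Y2: "Y\<^sup>2 = (x v)\<^sup>2" by (simp add: Y_def power_mult_distrib flip: power_mult)
  have sc: "sin \<psi> * cos \<psi> > 0"
    using \<psi> by (intro mult_pos_pos sin_gt_zero cos_gt_zero_pi) auto
  interpret pair_pseudo_graph G by fact
  have S: "S > 0"
  proof -
    obtain w where "w \<in> pverts G" "x w \<noteq> 0" using x unfolding Q_eigenfunction_def by blast
    then show ?thesis unfolding S_def by (intro sum_pos2[of _ w]) (auto simp: pair_finite_verts)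
  qed
  have E: "path_energy q a f + path_energy q b g + path_energy q c h - q * (X\<^sup>2 + Y\<^sup>2) = (k - q) * S"
    using theta_energy_eq[OF G x, of q] unfolding Y2 X_def f_def g_def h_def abc S_def .
  have F: "sin \<psi> * cos \<psi> * ((X + Y)\<^sup>2 * theta_sym \<psi> a b c + (X - Y)\<^sup>2 * theta_anti \<psi> a b c) \<le> (k - q) * S"
    using theta_energy_ge[where f = f and g = g and h = h, OF ge1 \<psi> lt ends]
    unfolding q_def[symmetric] E .
  show 1: "4 * (sin \<psi>)\<^sup>2 \<le> k" if "theta_sym \<psi> a b c \<ge> 0"
  proof -
    have "0 \<le> sin \<psi> * cos \<psi> * ((X + Y)\<^sup>2 * theta_sym \<psi> a b c + (X - Y)\<^sup>2 * theta_anti \<psi> a b c)"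
      using sc anti that by simp
    with F have "0 \<le> (k - q) * S" by linarith
    then show ?thesis using S by (simp add: zero_le_mult_iff q_def)
  qed
  show "4 * (sin \<psi>)\<^sup>2 < k" if sym: "theta_sym \<psi> a b c > 0"
  proof (rule ccontr)
    assume "\<not> 4 * (sin \<psi>)\<^sup>2 < k"
    then have kq: "k = q" using 1 sym by (simp add: q_def)
    have "(X + Y)\<^sup>2 * theta_sym \<psi> a b c + (X - Y)\<^sup>2 * theta_anti \<psi> a b c \<le> 0"
      using F sc unfolding kq by (metis diff_self mult_zero_left mult_le_0_iff not_le)
    moreover have "0 \<le> (X + Y)\<^sup>2 * theta_sym \<psi> a b c" "0 \<le> (X - Y)\<^sup>2 * theta_anti \<psi> a b c"
      using sym anti by simp_all
    ultimately have "(X + Y)\<^sup>2 * theta_sym \<psi> a b c = 0" "(X - Y)\<^sup>2 * theta_anti \<psi> a b c = 0" by linarith+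
    then have XY: "X = 0" "Y = 0" using sym anti by auto
    \<comment> \<open>With zero ends the three energies are nonnegative, and their sum is 0 because
      k = q; hence each is 0.\<close>
    have nonneg: "0 \<le> path_energy q a f" "0 \<le> path_energy q b g" "0 \<le> path_energy q c h"
      using path_energy_ge[OF ge1(1) \<psi>(1) lt(1), of f] path_energy_ge[OF ge1(2) \<psi>(1) lt(2), of g]
        path_energy_ge[OF ge1(3) \<psi>(1) lt(3), of h] by (simp_all add: ends XY q_def)
    then have le0: "path_energy q a f \<le> 0" "path_energy q b g \<le> 0" "path_energy q c h \<le> 0"
      using E unfolding kq XY by auto
    have zero: "f j = 0" if "j \<le> a" for j
      using path_energy_dirichlet_zero[OF ge1(1) \<psi>(1) lt(1), of f j] le0 ends XY that by (simp add: q_def)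
    moreover have "g j = 0" if "j \<le> b" for j
      using path_energy_dirichlet_zero[OF ge1(2) \<psi>(1) lt(2), of g j] le0 ends XY that by (simp add: q_def)
    moreover have "h j = 0" if "j \<le> c" for j
      using path_energy_dirichlet_zero[OF ge1(3) \<psi>(1) lt(3), of h j] le0 ends XY that by (simp add: q_def)
    moreover have "x w = 0" if "w \<in> set (u # m @ [v])" "\<And>j. j \<le> Suc (length m) \<Longrightarrow> alternating x (u # m @ [v]) j = 0" for m w
    proof -
      from that(1) obtain j where "j < length (u # m @ [v])" "w = (u # m @ [v]) ! j"
        unfolding in_set_conv_nth by blast
      then show ?thesis using that(2)[of j] by (simp add: alternating_def)
    qed
    ultimately have "x w = 0" if "w \<in> set (u # ps @ [v]) \<union> set (u # qs @ [v]) \<union> set (u # rs @ [v])" for w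
      using that unfolding f_def g_def h_def abc by blast
    then have "x w = 0" if "w \<in> pverts G" for w
      using that G(1) unfolding theta_presentation_def by auto
    then show False using x unfolding Q_eigenfunction_def by blast
  qed
qed

section \<open>Isomorphism and bipartiteness\<close>

lemma graph_isoI:
  assumes "pair_wf_digraph G" "inj_on h (pverts G)" "pverts H = h ` pverts G"
    and arcs: "parcs H = map_prod h h ` parcs G"
  shows "G \<simeq>\<^sub>G (H :: 'b pair_pre_digraph)"
proof -
  interpret pair_wf_digraph G by fact
  let ?hom = "\<lparr>iso_verts = h, iso_arcs = map_prod h h, iso_head = snd, iso_tail = fst\<rparr>"
  have "parcs G \<subseteq> pverts G \<times> pverts G" by (auto dest: in_arcsD1 in_arcsD2)
  then have "inj_on (map_prod h h) (parcs G)"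
    using map_prod_inj_on[OF assms(2) assms(2)] by (rule inj_on_subset[rotated])
  then have "pre_digraph.digraph_isomorphism (with_proj G) ?hom"
    unfolding pre_digraph.digraph_isomorphism_def using assms(2)
    by (auto simp: wf_digraph_wp_iff assms(1))
  moreover have "with_proj H = app_iso ?hom (with_proj G)"
    unfolding app_iso_def by (simp add: with_proj_def assms)
  ultimately show ?thesis unfolding digraph_iso_def by blast
qed

lemma graph_isoE:
  assumes "G \<simeq>\<^sub>G (H :: 'b pair_pre_digraph)"
  obtains h where "inj_on h (pverts G)" "pverts H = h ` pverts G" "parcs H = map_prod h h ` parcs G"
proof -
  from assms obtain f where f: "pre_digraph.digraph_isomorphism (with_proj G) f"
    and H: "with_proj H = app_iso f (with_proj G)" unfolding digraph_iso_def by blast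
  have eq: "pverts H = iso_verts f ` pverts G" "parcs H = iso_arcs f ` parcs G"
    "fst = iso_tail f" "snd = iso_head f"
    using arg_cong[OF H, of verts] arg_cong[OF H, of arcs] arg_cong[OF H, of tail] arg_cong[OF H, of head]
    by simp_all
  have "iso_arcs f e = map_prod (iso_verts f) (iso_verts f) e" if "e \<in> parcs G" for e
    using f that unfolding pre_digraph.digraph_isomorphism_def
    by (cases e) (auto simp: prod_eq_iff eq(3,4)[symmetric])
  then have "parcs H = map_prod (iso_verts f) (iso_verts f) ` parcs G"
    unfolding eq(2) by (intro image_cong) auto
  moreover have "inj_on (iso_verts f) (pverts G)"
    using f unfolding pre_digraph.digraph_isomorphism_def by simp
  ultimately show ?thesis using eq(1) that by blast
qed

lemma Q_eigenfunction_comp_iso: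
  assumes G: "pair_wf_digraph G" and h: "inj_on h (pverts G)" "pverts H = h ` pverts G" "parcs H = map_prod h h ` parcs G"
    and y: "Q_eigenfunction H k y"
  shows "Q_eigenfunction G k (y \<circ> h)"
proof -
  interpret pair_wf_digraph G by fact
  have "(\<Sum>z | (w, z) \<in> parcs G. (y \<circ> h) w + (y \<circ> h) z) = k * (y \<circ> h) w" if w: "w \<in> pverts G" for w
  proof -
    have "{z. (h w, z) \<in> parcs H} = h ` {z. (w, z) \<in> parcs G}"
      unfolding h(3) using h(1) w by (auto simp: inj_on_def dest: in_arcsD1 in_arcsD2)
    moreover have "inj_on h {z. (w, z) \<in> parcs G}"
      using h(1) by (rule inj_on_subset) (auto dest: in_arcsD2)
    ultimately have "(\<Sum>z | (h w, z) \<in> parcs H. y (h w) + y z) = (\<Sum>z | (w, z) \<in> parcs G. y (h w) + y (h z))"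
      by (simp only: sum.reindex o_def)
    moreover have "(\<Sum>z | (h w, z) \<in> parcs H. y (h w) + y z) = k * y (h w)"
      using y w unfolding Q_eigenfunction_def h(2) by blast
    ultimately show ?thesis by (simp only: o_def)
  qed
  then show ?thesis using y unfolding Q_eigenfunction_def h(2) by auto
qed

lemma distinct_map_exists:
  assumes "distinct xs" "length ys = length xs"
  obtains h where "map h xs = ys"
proof
  show "map (the \<circ> map_of (zip xs ys)) xs = ys"
    using assms by (intro nth_equalityI) (auto simp: map_of_zip_nth)
qed

text \<open>The three path lengths determine the graph: a presentation lists every vertex once, so
  matching positions is a bijection, and it carries path arcs to path arcs.\<close>

lemma theta_presentation_iso:
  assumes G: "theta_presentation G u v ps qs rs" "pair_wf_digraph G"
    and H: "theta_presentation H u' v' ps' qs' rs'"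
    and len: "length ps' = length ps" "length qs' = length qs" "length rs' = length rs"
  shows "G \<simeq>\<^sub>G H"
proof -
  have d: "distinct (u # v # ps @ qs @ rs)" "distinct (u' # v' # ps' @ qs' @ rs')"
    using G(1) H by (auto simp: theta_presentation_def)
  obtain h where h: "map h (u # v # ps @ qs @ rs) = u' # v' # ps' @ qs' @ rs'"
    using distinct_map_exists[OF d(1), of "u' # v' # ps' @ qs' @ rs'"] len by auto
  then have h': "h u = u'" "h v = v'" "map h ps = ps'" "map h qs = qs'" "map h rs = rs'"
    using len by auto
  have arcs: "set (vwalk_arcs (u' # map h m @ [v'])) = map_prod h h ` set (vwalk_arcs (u # m @ [v]))" for m
    using vwalk_arcs_map[of h "u # m @ [v]"] h' by simp
  show ?thesis
  proof (rule graph_isoI[OF G(2)])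
    show "inj_on h (pverts G)"
    proof -
      have "pverts G = set (u # v # ps @ qs @ rs)" using G(1) by (simp add: theta_presentation_def)
      then show ?thesis using d(2) unfolding h[symmetric] distinct_map by (simp only:)
    qed
    show "pverts H = h ` pverts G"
    proof -
      have "pverts G = set (u # v # ps @ qs @ rs)" "pverts H = set (u' # v' # ps' @ qs' @ rs')"
        using G(1) H by (simp_all add: theta_presentation_def)
      then show ?thesis unfolding h[symmetric] by (simp only: set_map)
    qed
    show "parcs H = map_prod h h ` parcs G"
    proof -
      have sw: "symcl (map_prod h h ` R) = map_prod h h ` symcl R" for R
        by (simp add: symcl_def image_Un image_image case_prod_unfold)
      show ?thesis using G(1) H unfolding theta_presentation_def
        by (simp only: h'(3-5)[symmetric] arcs sw image_Un[symmetric])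
    qed
  qed
qed

lemma theta_presentation_bipartite:
  assumes G: "theta_presentation G u v ps qs rs"
    and par: "even (length ps) \<longleftrightarrow> even (length qs)" "even (length ps) \<longleftrightarrow> even (length rs)"
  shows "bipartite G"
proof -
  \<comment> \<open>The colour of a vertex is the parity of its position along its path.
    \<open>v\<close> sits at position \<open>Suc (length m)\<close>, so equal parities of the
    lengths give it one consistent colour.\<close>
  define al where "al = (\<lambda>m :: 'a list. map odd [1..<Suc (length m)])"
  have d: "distinct (u # v # ps @ qs @ rs)" using G by (simp add: theta_presentation_def)
  obtain h where "map h (u # v # ps @ qs @ rs) = False # even (length ps) # al ps @ al qs @ al rs"
    using distinct_map_exists[OF d, of "False # even (length ps) # al ps @ al qs @ al rs"]
    by (auto simp: al_def simp del: upt_Suc)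
  then have h: "\<not> h u" "h v \<longleftrightarrow> even (length ps)" "map h ps = al ps" "map h qs = al qs" "map h rs = al rs"
    by (auto simp: al_def append_eq_append_conv simp del: upt_Suc)
  have alt: "h y \<noteq> h z" if "(y, z) \<in> set (vwalk_arcs (u # m @ [v]))" "map h m = al m"
    "h v \<longleftrightarrow> even (length m)" for m y z
  proof -
    let ?s = "u # m @ [v]"
    have s: "h (?s ! j) \<longleftrightarrow> odd j" if "j < length ?s" for j
    proof -
      have "j = 0 \<or> (\<exists>i<length m. j = Suc i) \<or> j = Suc (length m)"
        using that by (cases j) auto
      then show ?thesis
      proof (elim disjE exE conjE)
        fix i assume i: "i < length m" "j = Suc i"
        then have "h (m ! i) = al m ! i" using \<open>map h m = al m\<close> by (metis nth_map)
        then show ?thesis using i by (simp add: nth_append al_def del: upt_Suc)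
      qed (use h(1) \<open>h v \<longleftrightarrow> even (length m)\<close> in \<open>auto simp: nth_append\<close>)
    qed
    from that(1) obtain k where "Suc k < length ?s" "y = ?s ! k" "z = ?s ! Suc k"
      unfolding in_set_vwalk_arcs_iff by blast
    with s[of k] s[of "Suc k"] show ?thesis by simp
  qed
  have arc: "y \<in> pverts G \<and> z \<in> pverts G \<and> h y \<noteq> h z" if "(y, z) \<in> parcs G" for y z
  proof -
    have "\<exists>m\<in>{ps, qs, rs}. (y, z) \<in> set (vwalk_arcs (u # m @ [v])) \<or> (z, y) \<in> set (vwalk_arcs (u # m @ [v]))"
      using that G unfolding theta_presentation_def symcl_def by (auto simp del: vwalk_arcs_Cons)
    then obtain m where m: "m \<in> {ps, qs, rs}"
      and yz: "(y, z) \<in> set (vwalk_arcs (u # m @ [v])) \<or> (z, y) \<in> set (vwalk_arcs (u # m @ [v]))" by blast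
    have "y \<in> set (u # m @ [v])" "z \<in> set (u # m @ [v])"
      using yz unfolding in_set_vwalk_arcs_iff by (metis Suc_lessD nth_mem)+
    moreover have "set (u # m @ [v]) \<subseteq> pverts G"
      using m G unfolding theta_presentation_def by auto
    moreover have "map h m = al m" "h v \<longleftrightarrow> even (length m)" using m h par by auto
    ultimately show ?thesis using yz alt[of y z m] alt[of z y m] by blast
  qed
  then show ?thesis
    unfolding bipartite_def using arc
    by (intro exI[of _ "{w \<in> pverts G. h w}"] exI[of _ "{w \<in> pverts G. \<not> h w}"]) auto
qed

subsection \<open>The extremal graphs\<close>

lemma in_symcl_iff: "(y, z) \<in> symcl R \<longleftrightarrow> (y, z) \<in> R \<or> (z, y) \<in> R"
  by (auto simp: symcl_def)

lemma symcl_Un: "symcl (A \<union> B) = symcl A \<union> symcl B"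
  and symcl_swap: "symcl ((\<lambda>(y, z). (z, y)) ` A) = symcl A"
  by (auto simp: symcl_def)

lemma pair_pseudo_graph_symcl:
  assumes "finite V" "R \<subseteq> V \<times> V"
  shows "pair_pseudo_graph \<lparr>pverts = V, parcs = symcl R\<rparr>"
proof -
  have R: "symcl R \<subseteq> V \<times> V" using assms(2) by (auto simp: symcl_def)
  moreover have "finite (symcl R)" using R assms(1) by (meson finite_SigmaI finite_subset)
  moreover have "sym (symcl R)" by (auto simp: symcl_def sym_def)
  ultimately show ?thesis using assms(1)
    by unfold_locales (auto simp: symmetric_def)
qed

lemma in_parcs_cycle_graph_iff:
  assumes "n \<ge> 3" "i < n"
  shows "(i, z) \<in> parcs (cycle_graph n) \<longleftrightarrow>
    z = (if Suc i = n then 0 else Suc i) \<or> z = (if i = 0 then n - 1 else i - 1)"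
proof -
  have m: "(j + 1) mod n = (if Suc j = n then 0 else Suc j)" if "j < n" for j
    using that by auto
  have "(i, z) \<in> parcs (cycle_graph n) \<longleftrightarrow> z = (i + 1) mod n \<or> z < n \<and> i = (z + 1) mod n"
    using assms by (auto simp: cycle_graph_def symcl_def image_iff)
  also have "\<dots> \<longleftrightarrow> z = (if Suc i = n then 0 else Suc i) \<or> z < n \<and> i = (if Suc z = n then 0 else Suc z)"
    using m[OF assms(2)] m[of z] by auto
  finally show ?thesis using assms by auto
qed

text \<open>For \<theta> = pi + pi / n and odd n, n\<theta> = (n + 1) pi is a multiple of 2 pi, so
  cos j\<theta> closes up around the cycle. Its eigenvalue is 2 + 2 cos \<theta> = 2 - 2 cos (pi /
  n).\<close>

lemma Q_eigenfunction_cycle_graph: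
  assumes "odd n" "n \<ge> 3"
  shows "Q_eigenfunction (cycle_graph n) (4 * (sin (pi / (2 * real n)))\<^sup>2)
    (\<lambda>i. cos (real i * (pi + pi / real n)))"
proof -
  define \<theta> and x :: "nat \<Rightarrow> real" where "\<theta> = pi + pi / real n" and "x = (\<lambda>i. cos (real i * \<theta>))"
  have "real n * \<theta> = real (Suc n) * pi" using assms by (simp add: \<theta>_def field_simps)
  then have per: "cos (real n * \<theta>) = 1" "sin (real n * \<theta>) = 0"
    using assms(1) by (simp_all only: cos_npi sin_npi) simp
  have "cos (pi / real n) = 1 - 2 * (sin (pi / (2 * real n)))\<^sup>2"
    using cos_double_sin[of "pi / (2 * real n)"] by simp
  then have q: "4 * (sin (pi / (2 * real n)))\<^sup>2 = 2 * (1 + cos \<theta>)" by (simp add: \<theta>_def)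
  have "(\<Sum>z | (i, z) \<in> parcs (cycle_graph n). x i + x z) = 2 * (1 + cos \<theta>) * x i" if i: "i < n" for i
  proof -
    have s: "x (if Suc i = n then 0 else Suc i) = cos (real i * \<theta> + \<theta>)"
    proof (cases "Suc i = n")
      case True
      then have "real i * \<theta> + \<theta> = real n * \<theta>" by (auto simp: algebra_simps)
      then show ?thesis using True per by (simp add: x_def)
    qed (simp add: x_def algebra_simps)
    have p: "x (if i = 0 then n - 1 else i - 1) = cos (real i * \<theta> - \<theta>)"
    proof (cases "i = 0")
      case True
      have "real (n - 1) * \<theta> = real n * \<theta> - \<theta>" using assms by (simp add: algebra_simps of_nat_diff)
      then show ?thesis using True per by (simp add: x_def cos_diff)
    next
      case False
      then have "real (i - 1) * \<theta> = real i * \<theta> - \<theta>" by (simp add: algebra_simps of_nat_diff)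
      then show ?thesis using False by (simp add: x_def)
    qed
    have "{z. (i, z) \<in> parcs (cycle_graph n)}
      = {if Suc i = n then 0 else Suc i, if i = 0 then n - 1 else i - 1}"
      unfolding in_parcs_cycle_graph_iff[OF assms(2) i] by blast
    moreover have "(if Suc i = n then 0 else Suc i) \<noteq> (if i = 0 then n - 1 else i - 1)"
      using assms i by auto
    ultimately have "(\<Sum>z | (i, z) \<in> parcs (cycle_graph n). x i + x z)
      = 2 * x i + (cos (real i * \<theta> + \<theta>) + cos (real i * \<theta> - \<theta>))"
      unfolding s[symmetric] p[symmetric] by (simp only: sum.insert_if) simp
    also have "\<dots> = 2 * (1 + cos \<theta>) * x i" by (simp add: cos_add cos_diff x_def algebra_simps)
    finally show ?thesis .
  qed
  then show ?thesis
    unfolding Q_eigenfunction_def q x_def \<theta>_def[symmetric] using assms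
    by (auto simp: cycle_graph_def intro!: bexI[of _ 0] simp del: sum.distrib)
qed

lemma in_parcs_Theta_graph_iff:
  "(y, z) \<in> parcs (Theta_graph n) \<longleftrightarrow>
     1 \<le> y \<and> z = Suc y \<and> z < n \<or> 1 \<le> z \<and> y = Suc z \<and> y < n \<or>
     y = n - 1 \<and> z = 1 \<or> y = 1 \<and> z = n - 1 \<or>
     y = 0 \<and> (z = 2 \<or> z = n - 1) \<or> z = 0 \<and> (y = 2 \<or> y = n - 1)"
  unfolding Theta_graph_def pair_pre_digraph.simps in_symcl_iff by auto

text \<open>On the path from 2 to n - 1 the function is a sine, antisymmetric about the middle, with
  alternating signs and normalised to 1 at both ends. The twins 0 and 1 have the neighbours 2 and n
  - 1, and their equation forces the value - 1 / C.\<close>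

lemma Q_eigenfunction_Theta_graph:
  assumes n: "even n" "n \<ge> 4" and \<psi>: "0 < \<psi>" "real (n - 1) * \<psi> < pi / 2"
    and root: "theta_sym \<psi> 2 2 (n - 3) = 0"
  shows "\<exists>x. Q_eigenfunction (Theta_graph n) (4 * (sin \<psi>)\<^sup>2) (x :: nat \<Rightarrow> real)"
proof -
  define C S t where "C = cos (2 * \<psi>)" and "S = sin (2 * \<psi>)" and "t = real (n - 3) * \<psi>"
  have t: "t = (real n - 3) * \<psi>" using n by (simp add: t_def)
  define x where "x = (\<lambda>j. if j \<le> 1 then - 1 / C else (-1) ^ j * (sin ((real n + 1 - 2 * real j) * \<psi>) / sin t))"
  have n1: "(real n - 1) * \<psi> < pi / 2" using \<psi>(2) n by (simp add: of_nat_diff)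
  have "2 * \<psi> < (real n - 1) * \<psi>" "\<psi> \<le> t" "t < (real n - 1) * \<psi>"
    using \<psi>(1) n unfolding t by (simp_all)
  then have "2 * \<psi> < pi / 2" "0 < t" "t < pi" "- (pi / 2) < 2 * \<psi>" "- (pi / 2) < \<psi>" "\<psi> < pi / 2"
    using n1 \<psi>(1) by linarith+
  then have pos: "C > 0" "sin t > 0" "cos \<psi> > 0"
    unfolding C_def by (simp_all only: cos_gt_zero_pi sin_gt_zero)
  have q: "4 * (sin \<psi>)\<^sup>2 = 2 - 2 * C" by (simp add: C_def cos_double_sin)
  have CS: "C\<^sup>2 + S\<^sup>2 = 1" by (simp add: C_def S_def)
  have St: "S * tan \<psi> = 1 - C"
    using pos(3) by (simp add: S_def C_def sin_double cos_double_sin tan_def power2_eq_square)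
  \<comment> \<open>The root condition enters here. It yields \<open>r\<close>, which is exactly the
    equation at the two vertices of degree 3.\<close>
  have ct: "cot t = 2 * (S / C) - tan \<psi>"
    using root by (simp add: theta_sym_def t_def tan_def C_def S_def)
  have "S * cot t = 2 * S\<^sup>2 / C - S * tan \<psi>"
    unfolding ct by (simp add: power2_eq_square right_diff_distrib)
  then have Sc: "S * cot t = 2 * S\<^sup>2 / C - (1 - C)" unfolding St .
  have "sin (t - 2 * \<psi>) / sin t = C - S * cot t"
    using pos by (simp add: sin_diff cot_def C_def S_def field_simps)
  also have "\<dots> = 1 - 2 * S\<^sup>2 / C" unfolding Sc by simp
  also have "\<dots> = 1 + 2 * C - 2 / C"
  proof -
    have "2 * S\<^sup>2 / C = (2 - 2 * C\<^sup>2) / C" using CS by (simp add: algebra_simps)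
    then show ?thesis using pos by (simp add: field_simps power2_eq_square)
  qed
  finally have r: "sin (t - 2 * \<psi>) / sin t = 1 + 2 * C - 2 / C" .
  have x01: "x 0 = - 1 / C" "x 1 = - 1 / C" by (simp_all add: x_def)
  have x2: "x 2 = 1" using pos by (simp add: x_def t)
  have x3: "x 3 = - (1 + 2 * C - 2 / C)"
    unfolding r[symmetric] by (simp add: x_def t algebra_simps)
  have xn: "x (n - 1) = 1"
  proof -
    have "(-1) ^ (n - 1) = (- 1 :: real)" using n by simp
    moreover have "(real n + 1 - 2 * real (n - 1)) * \<psi> = - t" using n by (simp add: t of_nat_diff algebra_simps)
    moreover have "\<not> n - 1 \<le> 1" using n by simp
    ultimately have "x (n - 1) = - 1 * (sin (- t) / sin t)" unfolding x_def by (simp only: if_False)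
    then show ?thesis using pos by simp
  qed
  have xn2: "x (n - 2) = - (1 + 2 * C - 2 / C)"
  proof -
    have "(-1) ^ (n - 2) = (1 :: real)" using n by simp
    moreover have "(real n + 1 - 2 * real (n - 2)) * \<psi> = - (t - 2 * \<psi>)"
      using n by (simp add: t of_nat_diff algebra_simps)
    moreover have "\<not> n - 2 \<le> 1" using n by simp
    ultimately have "x (n - 2) = 1 * (sin (- (t - 2 * \<psi>)) / sin t)" unfolding x_def by (simp only: if_False)
    then show ?thesis unfolding r[symmetric] sin_minus by simp
  qed
  \<comment> \<open>The recurrence for vertices of degree 2 inside the long path; it is the addition
    formula for the sine.\<close>
  have step: "x (j - 1) + x (Suc j) = - 2 * C * x j" if "3 \<le> j" for j
  proof -
    define A s where "A = (real n + 1 - 2 * real j) * \<psi>" and "s = ((-1) ^ j :: real)"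
    have "(-1) ^ (j - 1) = - s" using that by (cases j) (auto simp: s_def)
    moreover have "(real n + 1 - 2 * real (j - 1)) * \<psi> = A + 2 * \<psi>"
      using that by (simp add: A_def of_nat_diff algebra_simps)
    moreover have "\<not> j - 1 \<le> 1" using that by simp
    ultimately have 1: "x (j - 1) = - s * (sin (A + 2 * \<psi>) / sin t)"
      unfolding x_def by (simp only: if_False)
    have "(real n + 1 - 2 * real (Suc j)) * \<psi> = A - 2 * \<psi>" by (simp add: A_def algebra_simps)
    then have 2: "x (Suc j) = - s * (sin (A - 2 * \<psi>) / sin t)"
      using that unfolding x_def s_def by (simp del: of_nat_Suc)
    have 3: "x j = s * (sin A / sin t)" using that by (simp add: x_def A_def s_def)
    have "sin (A + 2 * \<psi>) + sin (A - 2 * \<psi>) = 2 * C * sin A" by (simp add: sin_add sin_diff C_def)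
    moreover have "x (j - 1) + x (Suc j) = - s * ((sin (A + 2 * \<psi>) + sin (A - 2 * \<psi>)) / sin t)"
      unfolding 1 2 add_divide_distrib by (simp add: algebra_simps)
    ultimately show ?thesis unfolding 3 by simp
  qed
  have eq: "(\<Sum>z | (w, z) \<in> parcs (Theta_graph n). x w + x z) = (2 - 2 * C) * x w" if w: "w < n" for w
  proof -
    consider "w \<le> 1" | "w = 2" | "w = n - 1" | "3 \<le> w" "w \<le> n - 2" using w by linarith
    then show ?thesis
    proof cases
      case 1
      then have "{z. (w, z) \<in> parcs (Theta_graph n)} = {2, n - 1}"
        using n unfolding in_parcs_Theta_graph_iff by auto
      moreover have "x w = - 1 / C" using 1 by (simp add: x_def)
      ultimately show ?thesis using n x2 xn pos by (simp add: field_simps)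
    next
      case 2
      then have "{z. (w, z) \<in> parcs (Theta_graph n)} = {0, 1, 3}"
        using n unfolding in_parcs_Theta_graph_iff by auto
      then show ?thesis using x01 x2 x3 2 by simp
    next
      case 3
      then have "{z. (w, z) \<in> parcs (Theta_graph n)} = {0, 1, n - 2}"
        using n unfolding in_parcs_Theta_graph_iff by auto
      moreover have "n - 2 \<noteq> 0" "n - 2 \<noteq> 1" using n by auto
      ultimately show ?thesis using x01 xn xn2 3 by simp
    next
      case 4
      then have "{z. (w, z) \<in> parcs (Theta_graph n)} = {w - 1, Suc w}"
        using n unfolding in_parcs_Theta_graph_iff by auto
      then show ?thesis using step[OF 4(1)] by (simp add: algebra_simps)
    qed
  qed
  have "Q_eigenfunction (Theta_graph n) (4 * (sin \<psi>)\<^sup>2) x"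
    unfolding Q_eigenfunction_def q using eq x2 n
    by (auto simp: Theta_graph_def intro!: bexI[of _ 2] simp del: sum.distrib)
  then show ?thesis by blast
qed

lemma set_vwalk_arcs_upt: "set (vwalk_arcs [a..<b]) = {(j, Suc j) |j. a \<le> j \<and> Suc j < b}"
proof -
  have "(y, z) \<in> set (vwalk_arcs [a..<b]) \<longleftrightarrow> z = Suc y \<and> a \<le> y \<and> z < b" for y z
    unfolding in_set_vwalk_arcs_iff by (auto intro!: exI[of _ "y - a"])
  then show ?thesis by auto
qed

lemma set_vwalk_arcs_rev: "set (vwalk_arcs (rev s)) = (\<lambda>(y, z). (z, y)) ` set (vwalk_arcs s)"
proof (induction s rule: vwalk_arcs.induct)
  case (3 x y s)
  have "set (vwalk_arcs (rev (y # s) @ [x])) = insert (last (rev (y # s)), x) (set (vwalk_arcs (rev (y # s))))"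
    by (rule set_vwalk_arcs_snoc) simp
  with 3 show ?case by simp
qed auto

text \<open>The chord is the path with empty interior. The two arcs of the cycle between its ends
  have n - 2i edges and, through vertex 0, 2i edges.\<close>

lemma theta_presentation_H_graph:
  assumes i: "1 \<le> i" "2 * i + 3 \<le> n"
  shows "theta_presentation (H_graph n i) i (n - i) [] [Suc i..<n - i] (rev [0..<i] @ rev [Suc (n - i)..<n])"
proof -
  have 1: "i # [Suc i..<n - i] @ [n - i] = [i..<Suc (n - i)]"
    using i by (simp add: upt_conv_Cons)
  have 2: "i # (rev [0..<i] @ rev [Suc (n - i)..<n]) @ [n - i] = rev [0..<Suc i] @ rev [n - i..<n]"
    using i by (simp add: upt_conv_Cons[of "n - i" n])
  have ends: "last (rev [0..<Suc i]) = 0" "hd (rev [n - i..<n]) = n - 1"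
    using i by (simp_all add: last_rev hd_rev del: upt_Suc)
  have arcs: "set (vwalk_arcs (rev [0..<Suc i] @ rev [n - i..<n]))
    = (\<lambda>(y, z). (z, y)) ` {(j, Suc j) |j. j < i} \<union> {(0, n - 1)}
      \<union> (\<lambda>(y, z). (z, y)) ` {(j, Suc j) |j. n - i \<le> j \<and> Suc j < n}"
    using i ends by (subst vwalk_arcs_append)
      (auto simp: set_vwalk_arcs_rev set_vwalk_arcs_upt simp del: upt_Suc)
  have m: "(j + 1) mod n = (if Suc j = n then 0 else Suc j)" if "j < n" for j
    using that by auto
  have "{(j, (j + 1) mod n) |j. j < n} = {(j, Suc j) |j. Suc j < n} \<union> {(n - 1, 0)}"
  proof -
    have "{(j, (j + 1) mod n) |j. j < n} = {(j, if Suc j = n then 0 else Suc j) |j. j < n}"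
      unfolding setcompr_eq_image by (rule image_cong) (simp_all only: m mem_Collect_eq)
    also have "\<dots> = {(j, Suc j) |j. Suc j < n} \<union> {(n - 1, 0)}"
    proof -
      have "{j. j < n} = insert (n - 1) {j. Suc j < n}" using i by auto
      moreover have "(\<lambda>j. (j, if Suc j = n then 0 else Suc j)) ` {j. Suc j < n} = (\<lambda>j. (j, Suc j)) ` {j. Suc j < n}"
        by (rule image_cong) auto
      ultimately show ?thesis unfolding setcompr_eq_image using i by simp
    qed
    finally show ?thesis .
  qed
  then have H: "parcs (H_graph n i) = symcl ({(j, Suc j) |j. Suc j < n} \<union> {(n - 1, 0)}) \<union> symcl {(i, n - i)}"
    by (simp add: H_graph_def cycle_graph_def)
  have "parcs (H_graph n i) = symcl (set (vwalk_arcs (i # [] @ [n - i])) \<union> set (vwalk_arcs [i..<Suc (n - i)])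
      \<union> set (vwalk_arcs (rev [0..<Suc i] @ rev [n - i..<n])))"
  proof -
    have "{j. Suc j < n} = {j. i \<le> j \<and> Suc j < Suc (n - i)} \<union> {j. j < i} \<union> {j. n - i \<le> j \<and> Suc j < n}"
      using i by auto
    then have "{(j, Suc j) |j. Suc j < n} = {(j, Suc j) |j. i \<le> j \<and> Suc j < Suc (n - i)}
        \<union> {(j, Suc j) |j. j < i} \<union> {(j, Suc j) |j. n - i \<le> j \<and> Suc j < n}"
      unfolding setcompr_eq_image by (simp only: image_Un)
    \<comment> \<open>The path through 0 runs along this edge against the direction of the
      cycle.\<close>
    moreover have "symcl {(0, n - 1)} = symcl {(n - 1, 0)}"
      using symcl_swap[of "{(n - 1, 0)}"] by simp
    moreover have "set (vwalk_arcs (i # [] @ [n - i])) = {(i, n - i)}" by simp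
    ultimately show ?thesis
      unfolding H arcs set_vwalk_arcs_upt by (simp only: symcl_Un symcl_swap Un_ac)
  qed
  moreover have "pverts (H_graph n i)
    = set (i # (n - i) # [] @ [Suc i..<n - i] @ (rev [0..<i] @ rev [Suc (n - i)..<n]))"
    using i by (auto simp: H_graph_def cycle_graph_def)
  moreover have "distinct [[], [Suc i..<n - i], rev [0..<i] @ rev [Suc (n - i)..<n]]"
  proof -
    have "Suc i \<in> set [Suc i..<n - i]" "Suc i \<notin> set (rev [0..<i] @ rev [Suc (n - i)..<n])"
      "0 \<in> set (rev [0..<i] @ rev [Suc (n - i)..<n])"
      using i by auto
    then show ?thesis by (metis distinct_length_2_or_more distinct_singleton empty_iff empty_set)
  qed
  moreover have "distinct (i # (n - i) # [] @ [Suc i..<n - i] @ (rev [0..<i] @ rev [Suc (n - i)..<n]))"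
    using i by auto
  ultimately show ?thesis
    unfolding theta_presentation_def 1 2 by blast
qed

text \<open>The branch vertices are 2 and n - 1; the path lengths are 2, 2 and n - 3.\<close>

lemma theta_presentation_Theta_graph:
  assumes n: "n \<ge> 4"
  shows "theta_presentation (Theta_graph n) 2 (n - 1) [1] [0] [3..<n - 1]"
proof -
  have 1: "2 # [3..<n - 1] @ [n - 1] = [2..<n]"
    using n upt_conv_Cons[of 2 n] upt_Suc_append[of 3 "n - 1"] by (simp add: numeral_3_eq_3)
  have "parcs (Theta_graph n) = symcl (set (vwalk_arcs (2 # [1] @ [n - 1]))
      \<union> set (vwalk_arcs (2 # [0] @ [n - 1])) \<union> set (vwalk_arcs [2..<n]))"
  proof -
    have s: "set (vwalk_arcs (2 # [1] @ [n - 1])) = {(2, 1), (1, n - 1)}"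
      "set (vwalk_arcs (2 # [0] @ [n - 1])) = {(2, 0), (0, n - 1)}" by simp_all
    have "(y, z) \<in> parcs (Theta_graph n) \<longleftrightarrow> (y, z) \<in> symcl (set (vwalk_arcs (2 # [1] @ [n - 1]))
      \<union> set (vwalk_arcs (2 # [0] @ [n - 1])) \<union> set (vwalk_arcs [2..<n]))" for y z
    proof -
      have "1 \<le> a \<and> b = Suc a \<and> b < n \<longleftrightarrow> a = 1 \<and> b = 2 \<or> 2 \<le> a \<and> b = Suc a \<and> b < n" for a b
        using n by auto
      then show ?thesis
        unfolding in_parcs_Theta_graph_iff set_vwalk_arcs_upt in_symcl_iff s by auto
    qed
    then show ?thesis by auto
  qed
  moreover have "1 \<notin> set [3..<n - 1]" "0 \<notin> set [3..<n - 1]" by simp_all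
  then have "distinct [[1], [0], [3..<n - 1]]"
    by (metis distinct_length_2_or_more distinct_singleton list.set_intros(1) zero_neq_one list.inject)
  moreover have "pverts (Theta_graph n) = set (2 # (n - 1) # [1] @ [0] @ [3..<n - 1])"
    using n by (auto simp: Theta_graph_def)
  moreover have "distinct (2 # (n - 1) # [1] @ [0] @ [3..<n - 1])" using n by auto
  ultimately show ?thesis unfolding theta_presentation_def 1 by blast
qed

subsection \<open>The least eigenvalue\<close>

text \<open>Three path lengths of equal parity would give a bipartition, so exactly two agree; the
  swaps move the third one to the last place.\<close>

lemma theta_presentation_parity:
  assumes "theta_graph G" "\<not> bipartite G"
  obtains u v ps qs rs where "theta_presentation G u v ps qs rs"
    "even (length ps) \<longleftrightarrow> even (length qs)" "even (length ps) \<longleftrightarrow> odd (length rs)"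
proof -
  obtain u v ps qs rs where G: "theta_presentation G u v ps qs rs"
    using theta_presentation_exists[OF assms(1)] .
  note G' = G theta_presentation_swap23[OF G] theta_presentation_swap23[OF theta_presentation_swap12[OF G]]
  have "\<not> ((even (length ps) \<longleftrightarrow> even (length qs)) \<and> (even (length ps) \<longleftrightarrow> even (length rs)))"
    using theta_presentation_bipartite[OF G] assms(2) by blast
  then consider "even (length ps) \<longleftrightarrow> even (length qs)" "even (length ps) \<longleftrightarrow> odd (length rs)"
    | "even (length ps) \<longleftrightarrow> even (length rs)" "even (length ps) \<longleftrightarrow> odd (length qs)"
    | "even (length qs) \<longleftrightarrow> even (length rs)" "even (length qs) \<longleftrightarrow> odd (length ps)"
    by blast
  then show ?thesis by cases (use that G' in blast)+
qed

lemma least_Q_eigenvalue_iso_le: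
  assumes "pair_pseudo_graph G" "pair_pseudo_graph H" "pverts H \<noteq> {}" "G \<simeq>\<^sub>G (H :: 'b pair_pre_digraph)"
  shows "least_Q_eigenvalue G \<le> least_Q_eigenvalue H"
proof -
  interpret pair_pseudo_graph G by fact
  obtain h where h: "inj_on h (pverts G)" "pverts H = h ` pverts G" "parcs H = map_prod h h ` parcs G"
    using graph_isoE[OF assms(4)] .
  obtain y where "Q_eigenfunction H (least_Q_eigenvalue H) y"
    using least_Q_eigenvalue_attained[OF assms(2,3)] by blast
  then have "Q_eigenfunction G (least_Q_eigenvalue H) (y \<circ> h)"
    using Q_eigenfunction_comp_iso[OF _ h] pair_wf_digraph_axioms by blast
  moreover have "pverts G \<noteq> {}" using assms(3) h(2) by simp
  ultimately show ?thesis by (intro least_Q_eigenvalue_le[OF assms(1)])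
qed

lemma theta_graph_odd_order:
  assumes G: "theta_graph G" "\<not> bipartite G" and n: "card (pverts G) = n" "n \<ge> 4" "odd n"
  shows "least_Q_eigenvalue (cycle_graph n) \<le> least_Q_eigenvalue G"
    and "least_Q_eigenvalue (cycle_graph n) = least_Q_eigenvalue G \<Longrightarrow>
      \<exists>i. 1 \<le> i \<and> i \<le> (n - 3) div 2 \<and> G \<simeq>\<^sub>G H_graph n i"
proof -
  interpret pair_graph G using G(1) by (simp add: theta_graph_def)
  have ps: "pair_pseudo_graph G" by unfold_locales
  define \<psi> where "\<psi> = pi / (2 * real n)"
  have np: "real n * \<psi> = pi / 2" and \<psi>: "0 < \<psi>" using n by (simp_all add: \<psi>_def)
  have lt: "real m * \<psi> < pi / 2" if "m < n" for m
    using that \<psi> unfolding np[symmetric] by simp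
  have C: "least_Q_eigenvalue (cycle_graph n) \<le> 4 * (sin \<psi>)\<^sup>2"
  proof (rule least_Q_eigenvalue_le)
    show "pair_pseudo_graph (cycle_graph n)"
      unfolding cycle_graph_def by (rule pair_pseudo_graph_symcl) auto
    show "pverts (cycle_graph n) \<noteq> {}" using n by (simp add: cycle_graph_def lessThan_empty_iff)
  qed (use Q_eigenfunction_cycle_graph[of n] n in \<open>simp add: \<psi>_def\<close>)
  obtain u v ps qs rs where P: "theta_presentation G u v ps qs rs"
    and par: "even (length ps) \<longleftrightarrow> even (length qs)" "even (length ps) \<longleftrightarrow> odd (length rs)"
    using theta_presentation_parity[OF G] .
  define a b c where "a = Suc (length ps)" and "b = Suc (length qs)" and "c = Suc (length rs)"
  have d: "distinct (u # v # ps @ qs @ rs)" "distinct [ps, qs, rs]" "pverts G = set (u # v # ps @ qs @ rs)"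
    using P by (auto simp: theta_presentation_def)
  have sum: "a + b + c = n + 1"
    using distinct_card[OF d(1)] n(1) unfolding d(3) by (simp add: a_def b_def c_def)
  have ge: "a \<ge> 1" "b \<ge> 1" "c \<ge> 1" by (simp_all add: a_def b_def c_def)
  have pabc: "even a \<longleftrightarrow> even b" "even a \<longleftrightarrow> odd c" using par by (simp_all add: a_def b_def c_def)
  have "odd a"
  proof
    assume "even a"
    then have "odd (a + b + c)" using pabc by simp
    then show False using sum n(3) by simp
  qed
  have l: "real a * \<psi> < pi / 2" "real b * \<psi> < pi / 2" "real c * \<psi> < pi / 2" "\<psi> < pi / 2"
    using lt[of a] lt[of b] lt[of c] lt[of 1] sum ge n by auto
  \<comment> \<open>b + c is at most n because a is at least 1.\<close>
  have "real (b + c) * \<psi> \<le> real n * \<psi>" using sum ge \<psi> by (intro mult_right_mono) auto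
  then have anti: "theta_anti \<psi> a b c > 0"
    using ge \<psi> l np by (intro theta_anti_pos) auto
  obtain x where x: "Q_eigenfunction G (least_Q_eigenvalue G) x"
    using least_Q_eigenvalue_attained[OF ps] d(3) by auto
  note bounds = theta_eigenvalue_bounds[OF P ps x a_def b_def c_def pabc \<psi> l(4) l(1-3) anti]
  note sym = theta_sym_odd_order[OF sum ge \<psi>_def]
  show "least_Q_eigenvalue (cycle_graph n) \<le> least_Q_eigenvalue G"
    using C bounds(1)[OF sym(1)] by simp
  assume eq: "least_Q_eigenvalue (cycle_graph n) = least_Q_eigenvalue G"
  \<comment> \<open>Equality rules out the strict bound, so one of the two paths of equal parity is
    a single edge, the chord of H(i).\<close>
  have "\<not> (a > 1 \<and> b > 1)" using C eq bounds(2)[OF sym(2)] by auto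
  then have "ps = [] \<or> qs = []" by (auto simp: a_def b_def)
  then obtain qs' where P': "theta_presentation G u v [] qs' rs" and qs': "length qs' + c + 1 = n" "even (length qs')"
  proof
    assume "ps = []"
    then show ?thesis using that[of qs] P sum par by (simp add: a_def b_def)
  next
    assume "qs = []"
    then show ?thesis using that[of ps] theta_presentation_swap12[OF P] sum par by (simp add: a_def b_def)
  qed
  \<comment> \<open>In H(i) the path through vertex 0 has 2i edges, and \<open>c\<close> is
    even.\<close>
  define i where "i = c div 2"
  have "even c" using \<open>odd a\<close> pabc by simp
  then have c: "c = 2 * i" by (simp add: i_def)
  have i1: "1 \<le> i" using c ge by simp
  have "qs' \<noteq> []" using P' by (auto simp: theta_presentation_def)
  \<comment> \<open>The list is nonempty of even length; this is the upper bound on i. The case rule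
    merely separates lists with none, one and at least two entries.\<close>
  then have "2 \<le> length qs'" using qs'(2) by (cases qs' rule: remdups_adj.cases) auto
  then have i2: "2 * i + 3 \<le> n" using qs'(1) c by simp
  have "G \<simeq>\<^sub>G H_graph n i"
  proof (rule theta_presentation_iso[OF P' _ theta_presentation_H_graph[OF i1 i2]])
    show "pair_wf_digraph G" by unfold_locales
    show "length [Suc i..<n - i] = length qs'" using qs'(1) c by simp
    show "length (rev [0..<i] @ rev [Suc (n - i)..<n]) = length rs" using c c_def i1 i2 by simp
  qed simp
  then show "\<exists>i. 1 \<le> i \<and> i \<le> (n - 3) div 2 \<and> G \<simeq>\<^sub>G H_graph n i" using i1 i2 by auto
qed

lemma theta_graph_even_order:
  assumes G: "theta_graph G" "\<not> bipartite G" and n: "card (pverts G) = n" "n \<ge> 4" "even n"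
  shows "least_Q_eigenvalue (Theta_graph n) \<le> least_Q_eigenvalue G"
    and "least_Q_eigenvalue (Theta_graph n) = least_Q_eigenvalue G \<longleftrightarrow> G \<simeq>\<^sub>G Theta_graph n"
proof -
  interpret pair_graph G using G(1) by (simp add: theta_graph_def)
  have ps: "pair_pseudo_graph G" by unfold_locales
  obtain \<psi> where \<psi>: "0 < \<psi>" and n\<psi>: "pi / 2 \<le> real n * \<psi>" "real (n - 1) * \<psi> < pi / 2"
    and root: "theta_sym \<psi> 2 2 (n - 3) = 0"
    using theta_sym_root_exists[OF n(2)] .
  have lt: "real m * \<psi> < pi / 2" if "m \<le> n - 1" for m
    using le_less_trans[OF mult_right_mono n\<psi>(2), of "real m"] that \<psi> by simp
  have T: "pair_pseudo_graph (Theta_graph n)" "pverts (Theta_graph n) \<noteq> {}"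
    unfolding Theta_graph_def
    by (rule pair_pseudo_graph_symcl) (use n(2) in \<open>auto simp: lessThan_empty_iff\<close>)
  have TQ: "least_Q_eigenvalue (Theta_graph n) \<le> 4 * (sin \<psi>)\<^sup>2"
    using Q_eigenfunction_Theta_graph[OF n(3,2) \<psi> n\<psi>(2) root] least_Q_eigenvalue_le[OF T] by blast
  obtain u v ps qs rs where P: "theta_presentation G u v ps qs rs"
    and par: "even (length ps) \<longleftrightarrow> even (length qs)" "even (length ps) \<longleftrightarrow> odd (length rs)"
    using theta_presentation_parity[OF G] .
  define a b c where "a = Suc (length ps)" and "b = Suc (length qs)" and "c = Suc (length rs)"
  have d: "distinct (u # v # ps @ qs @ rs)" "pverts G = set (u # v # ps @ qs @ rs)"
    using P by (auto simp: theta_presentation_def)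
  have sum: "a + b + c = n + 1"
    using distinct_card[OF d(1)] n(1) unfolding d(2) by (simp add: a_def b_def c_def)
  have pabc: "even a \<longleftrightarrow> even b" "even a \<longleftrightarrow> odd c" using par by (simp_all add: a_def b_def c_def)
  \<comment> \<open>The lengths sum to the odd number n + 1, so the two of equal parity are even,
    hence at least 2.\<close>
  have "even a"
  proof (rule ccontr)
    assume "odd a"
    then have "even (a + b + c)" using pabc by simp
    then show False using sum n(3) by simp
  qed
  moreover have "a > 0" "b > 0" by (simp_all add: a_def b_def)
  ultimately have ge: "a \<ge> 2" "b \<ge> 2" "c \<ge> 1"
    using pabc by (auto simp: c_def elim!: evenE)
  have l: "real a * \<psi> < pi / 2" "real b * \<psi> < pi / 2" "real c * \<psi> < pi / 2" "\<psi> < pi / 2"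
    using lt[of a] lt[of b] lt[of c] lt[of 1] sum ge n by auto
  have anti: "theta_anti \<psi> a b c > 0"
  proof -
    have "real (b + c) * \<psi> < pi / 2" using sum ge by (intro lt) linarith
    then show ?thesis using ge \<psi> l by (intro theta_anti_pos) auto
  qed
  obtain x where x: "Q_eigenfunction G (least_Q_eigenvalue G) x"
    using least_Q_eigenvalue_attained[OF ps] d(2) by auto
  note bounds = theta_eigenvalue_bounds[OF P ps x a_def b_def c_def pabc \<psi> l(4) l(1-3) anti]
  have sym: "theta_sym \<psi> a b c > 0" if "a + b > 4"
    using theta_sym_even_order[OF sum ge that \<psi> n\<psi>(2,1) root] .
  have ab: "a = 2 \<and> b = 2 \<and> c = n - 3" if "\<not> a + b > 4" using that ge sum by auto
  have "theta_sym \<psi> a b c \<ge> 0" using sym ab root by (cases "a + b > 4") auto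
  from bounds(1)[OF this] TQ show le: "least_Q_eigenvalue (Theta_graph n) \<le> least_Q_eigenvalue G" by simp
  show "least_Q_eigenvalue (Theta_graph n) = least_Q_eigenvalue G \<longleftrightarrow> G \<simeq>\<^sub>G Theta_graph n"
  proof
    assume "least_Q_eigenvalue (Theta_graph n) = least_Q_eigenvalue G"
    \<comment> \<open>Equality excludes the strict bound, which leaves only the lengths of
      \<Theta>.\<close>
    then have "\<not> a + b > 4" using bounds(2)[OF sym] TQ by linarith
    from ab[OF this] have len: "length ps = 1" "length qs = 1" "length rs = n - 4"
      unfolding a_def b_def c_def by linarith+
    show "G \<simeq>\<^sub>G Theta_graph n"
    proof (rule theta_presentation_iso[OF P _ theta_presentation_Theta_graph[OF n(2)]])
      show "pair_wf_digraph G" by unfold_locales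
    qed (use len in auto)
  next
    \<comment> \<open>Transporting an eigenfunction gives one inequality; the other is the bound
      already shown.\<close>
    assume "G \<simeq>\<^sub>G Theta_graph n"
    then show "least_Q_eigenvalue (Theta_graph n) = least_Q_eigenvalue G"
      using least_Q_eigenvalue_iso_le[OF ps T] le by simp
  qed
qed

theorem theorem1p2:
  fixes G :: "'a pair_pre_digraph" and n :: nat
  assumes "theta_graph G"
    and "\<not> bipartite G"
    and "card (pverts G) = n"
    and "n \<ge> 4"
  shows "(odd n \<longrightarrow>
            least_Q_eigenvalue (cycle_graph n) \<le> least_Q_eigenvalue G \<and>
            (least_Q_eigenvalue (cycle_graph n) = least_Q_eigenvalue G \<longrightarrow>
               G \<simeq>\<^sub>G cycle_graph n \<or>
               (\<exists>i. 1 \<le> i \<and> i \<le> (n - 3) div 2 \<and> G \<simeq>\<^sub>G H_graph n i)))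
       \<and> (even n \<longrightarrow>
            least_Q_eigenvalue (Theta_graph n) \<le> least_Q_eigenvalue G \<and>
            (least_Q_eigenvalue (Theta_graph n) = least_Q_eigenvalue G \<longleftrightarrow>
               G \<simeq>\<^sub>G Theta_graph n))"
  using theta_graph_odd_order[OF assms] theta_graph_even_order[OF assms] by blast

end
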